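(* Let $D$ be a strong balanced bipartite digraph of order $2a$ with partite sets $V_1$ and $V_2$, where $a\ge 3$. If $D$ satisfies the condition $M_{-1}$, i.e. $d(u)+d(v)\ge 3a-1$ for all pairs of non-adjacent vertices $u,v$ of $D$, then $D$ is either hamiltonian or isomorphic to a digraph in $\mathcal{H}_1$ or to the digraph $H_2$.
   Context: Digraphs are finite, without loops and without multiple arcs (the two opposite arcs $xy$ and $yx$ may both be present). $V(D)$ and $A(D)$ denote the vertex set and arc set. $d(v)=d^+(v)+d^-(v)$ is the sum of the out-degree and the in-degree of $v$ in $D$. Two distinct vertices $u,v$ are non-adjacent if $uv\notin A(D)$ and $vu\notin A(D)$; in particular, two distinct vertices in the same partite set of a bipartite digraph are non-adjacent. $D$ is strong if for every ordered pair of vertices $x,y$ there is a directed path from $x$ to $y$. $D$ is bipartite if $V(D)$ is the disjoint union of two independent sets $V_1,V_2$ (the partite sets), and balanced if $|V_1|=|V_2|$. $D$ is hamiltonian if it contains a directed cycle through all its vertices. We write $x\leftrightarrow y$ if both $xy$ and $yx$ are arcs. The family $\mathcal{H}_1$: it is defined for odd $a\ge 3$ (there is no digraph of order $2a$ in $\mathcal{H}_1$ when $a$ is even). A digraph $H_1$ of order $2a$ belongs to $\mathcal{H}_1$ if it is bipartite with partite sets $V_1,V_2$, where $V_1$ is a disjoint union of $S$ and $R$, $V_2$ is a disjoint union of $U$ and $W$, $|S|=|W|=\frac{a+1}{2}$, $|U|=|R|=\frac{a-1}{2}$, and $A(H_1)$ consists exactly of the following arcs: (a) $rw$ and $wr$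 for all $r\in R$, $w\in W$; (b) $us$ and $su$ for all $u\in U$, $s\in S$; (c) $ws$ for all $w\in W$, $s\in S$ (and no arc from $S$ to $W$); (d) some arcs between $R$ and $U$ (in either or both directions) such that there exist $r\in R$ and $u\in U$ with $ur\in A(H_1)$; for every $r\in R$ the total number of arcs (in both directions) between $r$ and $U$ is at least $\frac{a-3}{2}$; and for every $u\in U$ the total number of arcs (in both directions) between $u$ and $R$ is at least $\frac{a-3}{2}$. The digraph $H_2$: it is the bipartite digraph with partite sets $X=\{x_1,x_2,x_3\}$ and $Y=\{y_1,y_2,y_3\}$ whose arc set consists exactly of the arcs $x_1y_2$, $y_2x_3$, $x_3y_3$, $y_3x_1$ and the 2-cycles $x_2\leftrightarrow y_2$, $x_2\leftrightarrow y_3$, $y_1\leftrightarrow x_1$, $y_1\leftrightarrow x_3$. *)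

theory Defs
  imports "Graph_Theory.Graph_Theory"
begin

definition degree :: "('a, 'b) pre_digraph \<Rightarrow> 'a \<Rightarrow> nat" where
  "degree D v = out_degree D v + in_degree D v"

definition nonadjacent :: "('a, 'b) pre_digraph \<Rightarrow> 'a \<Rightarrow> 'a \<Rightarrow> bool" where
  "nonadjacent D u v \<longleftrightarrow>
     u \<in> verts D \<and> v \<in> verts D \<and> u \<noteq> v \<and> (u, v) \<notin> arcs_ends D \<and> (v, u) \<notin> arcs_ends D"

definition independent_set :: "('a, 'b) pre_digraph \<Rightarrow> 'a set \<Rightarrow> bool" where
  "independent_set D X \<longleftrightarrow> X \<subseteq> verts D \<and> (\<forall>u\<in>X. \<forall>v\<in>X. (u, v) \<notin> arcs_ends D)"

definition partite_sets :: "('a, 'b) pre_digraph \<Rightarrow> 'a set \<Rightarrow> 'a set \<Rightarrow> bool" where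
  "partite_sets D V1 V2 \<longleftrightarrow>
     verts D = V1 \<union> V2 \<and> V1 \<inter> V2 = {} \<and> independent_set D V1 \<and> independent_set D V2"

definition hamiltonian :: "('a, 'b) pre_digraph \<Rightarrow> bool" where
  "hamiltonian D \<longleftrightarrow> (\<exists>p. pre_digraph.cycle D p \<and> tail D ` set p = verts D)"

text \<open>The condition \<open>M\<^sub>k\<close> for a bipartite digraph of order \<open>2a\<close>;
  the bound \<open>3a + k\<close> is taken in the integers because \<open>k\<close> may be negative.\<close>

definition condition_M :: "int \<Rightarrow> nat \<Rightarrow> ('a, 'b) pre_digraph \<Rightarrow> bool" where
  "condition_M k a D \<longleftrightarrow>
     (\<forall>u v. nonadjacent D u v \<longrightarrow> int (degree D u) + int (degree D v) \<ge> 3 * int a + k)"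

text \<open>\<open>E\<close> is the set of arcs between \<open>R\<close> and \<open>U\<close>. The divisions by 2 are exact since
  \<open>a\<close> is odd, and \<open>a - 3\<close> is not truncated since \<open>a \<ge> 3\<close>.\<close>

definition H1_family :: "('a, 'b) pre_digraph set" where
  "H1_family = {H. digraph H \<and>
     (\<exists>a V1 V2 S R U W E.
        odd a \<and> a \<ge> 3 \<and> card (verts H) = 2 * a \<and>
        partite_sets H V1 V2 \<and>
        V1 = S \<union> R \<and> S \<inter> R = {} \<and> V2 = U \<union> W \<and> U \<inter> W = {} \<and>
        card S = (a + 1) div 2 \<and> card W = (a + 1) div 2 \<and>
        card U = (a - 1) div 2 \<and> card R = (a - 1) div 2 \<and>
        arcs_ends H = (R \<times> W \<union> W \<times> R) \<union> (U \<times> S \<union> S \<times> U) \<union> W \<times> S \<union> E \<and>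
        E \<subseteq> R \<times> U \<union> U \<times> R \<and>
        (\<exists>r\<in>R. \<exists>u\<in>U. (u, r) \<in> E) \<and>
        (\<forall>r\<in>R. card (E \<inter> ({r} \<times> U \<union> U \<times> {r})) \<ge> (a - 3) div 2) \<and>
        (\<forall>u\<in>U. card (E \<inter> ({u} \<times> R \<union> R \<times> {u})) \<ge> (a - 3) div 2))}"

datatype H2_vertex = X1 | X2 | X3 | Y1 | Y2 | Y3

definition H2 :: "H2_vertex pair_pre_digraph" where
  "H2 = \<lparr> pverts = {X1, X2, X3, Y1, Y2, Y3},
          parcs = {(X1, Y2), (Y2, X3), (X3, Y3), (Y3, X1),
                   (X2, Y2), (Y2, X2), (X2, Y3), (Y3, X2),
                   (Y1, X1), (X1, Y1), (Y1, X3), (X3, Y1)} \<rparr>"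

end

theory Submission
  imports Defs
begin

text \<open>Write \<open>A\<close> for the arc set. If some set \<open>S\<close> of vertices on one side has fewer than \<open>|S|\<close>
out-neighbours, the set \<open>W\<close> of the other side that receives no arc from \<open>S\<close> satisfies
\<open>|S| + |W| > a\<close>. Two vertices of \<open>S\<close> have degree sum at most \<open>2 (2a - |W|)\<close>, and two of \<open>W\<close> have at
most \<open>2 (2a - |S|)\<close>, so the degree condition forces \<open>|S| = |W| = (a + 1) / 2\<close> with equality
everywhere (strong connectivity excludes that \<open>S\<close> or \<open>W\<close> is a single vertex); this is the family \<open>\<H>\<^sub>1\<close> (\<open>matching_or_H1_shape\<close>). Otherwise Hall's theorem gives
perfect matchings in both directions, that is, a permutation \<open>f\<close> of the vertices along arcs, whose
orbits are disjoint directed cycles covering the digraph.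

Choose \<open>f\<close> so that no other such permutation has a larger orbit relation. If \<open>u\<close> and \<open>z\<close> lie in
different orbits, then \<open>u \<rightarrow> f z\<close> and \<open>z \<rightarrow> f u\<close> cannot both be arcs, for exchanging the two images
would merge the orbits. Hence for an invariant set \<open>K\<close> with \<open>m\<close> vertices on each side at
most half of the possible arcs between \<open>K\<close> and its complement are present, and the degrees in \<open>K\<close>
sum to at most \<open>2m(a + m)\<close>, short of this bound by one for each pair that contributes no arc and by two for
each arc missing inside \<open>K\<close> (\<open>degree_count\<close>). The degree condition asks for
about \<open>m(3a - 1)\<close>, so small invariant sets are almost impossible.

Suppose that the digraph is not hamiltonian, so that \<open>f\<close> has more than one orbit. If all orbits have length at least four, there are
exactly two, of almost equal size, and parity leaves room for at most one defect.
One of the two, \<open>C\<close>, then induces a complete bipartite digraph, so it can be traversed from any vertex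
to any vertex of the other side; a counting argument along the other orbit finds a vertex \<open>w\<close> with no
arc to or from \<open>C\<close>, and \<open>w\<close> and \<open>C\<close> contradict the degree condition
(\<open>two_cycle_exists\<close>). If \<open>f\<close> has a 2-cycle \<open>x \<leftrightarrow> y\<close>, the degree condition, applied also to
non-adjacent vertices on opposite sides, gives \<open>d(x) = d(y) = a + 1\<close>, and all other vertices
form one orbit. Again some \<open>w\<close> in that orbit, without loss of generality on the side of \<open>x\<close>, is
adjacent to neither \<open>x\<close> nor \<open>y\<close>; it is then joined in both directions to everything else on the
opposite side. Counting the arcs at \<open>y\<close> produces a vertex \<open>g\<close> joined to \<open>y\<close> in both
directions, and rerouting through \<open>w\<close> and \<open>g\<close> shows that every vertex of that side except \<open>w\<close> is joined
to \<open>y\<close> in both directions. Hence \<open>2 (a - 1) \<le> a + 1\<close>, so \<open>a = 3\<close>, and the arcs are exactly those of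
\<open>H\<^sub>2\<close> (\<open>two_cycle_H2\<close>).\<close>

section \<open>Hall's theorem and degree sums from pairs\<close>

text \<open>Rado's argument: if some \<open>N x0\<close> still has two elements \<open>y1\<close> and \<open>y2\<close>, one of them can be deleted.
Otherwise there are sets \<open>insert x0 S1\<close> and \<open>insert x0 S2\<close> that violate Hall's condition after the
deletion of \<open>y1\<close> and of \<open>y2\<close> respectively; their neighbourhoods have a union containing that of
\<open>insert x0 (S1 \<union> S2)\<close> and an intersection containing that of \<open>S1 \<inter> S2\<close>, which contradicts Hall's
condition for these two sets by counting.\<close>

lemma hall_marriage:
  fixes N :: "'a \<Rightarrow> 'b set"
  assumes "finite X" and "\<And>x. x \<in> X \<Longrightarrow> finite (N x)"
    and "\<And>S. S \<subseteq> X \<Longrightarrow> card S \<le> card (\<Union>(N ` S))"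
  shows "\<exists>f. inj_on f X \<and> (\<forall>x\<in>X. f x \<in> N x)"
  using assms(2,3)
proof (induction "\<Sum>x\<in>X. card (N x)" arbitrary: N rule: less_induct)
  case less
  note fin = \<open>finite X\<close>
  note finN = less.prems(1)
  note hall = less.prems(2)
  show ?case
  proof (cases "\<exists>x0\<in>X. card (N x0) \<ge> 2")
    case False
    have one: "card (N x) = 1" if "x \<in> X" for x
    proof -
      have "card {x} \<le> card (\<Union>(N ` {x}))" using that by (intro hall) auto
      then show ?thesis using False that by force
    qed
    then have ex: "\<exists>y. N x = {y}" if "x \<in> X" for x using that card_1_singletonE by metis
    define f where "f = (\<lambda>x. THE y. N x = {y})"
    have f: "N x = {f x}" if "x \<in> X" for x
      using ex[OF that] unfolding f_def by auto
    have "inj_on f X"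
    proof (rule inj_onI, rule ccontr)
      fix x x' assume x: "x \<in> X" "x' \<in> X" "f x = f x'" "x \<noteq> x'"
      have "card {x, x'} \<le> card (\<Union>(N ` {x, x'}))" using x by (intro hall) auto
      then show False using x f[of x] f[of x'] by simp
    qed
    then show ?thesis using f by auto
  next
    case True
    then obtain x0 where x0: "x0 \<in> X" "card (N x0) \<ge> 2" by auto
    then obtain y1 y2 where y: "y1 \<in> N x0" "y2 \<in> N x0" "y1 \<noteq> y2"
      using card_le_Suc0_iff_eq[OF finN[OF x0(1)]] by fastforce
    define M where "M = (\<lambda>y. N(x0 := N x0 - {y}))"
    have finM: "\<And>y x. x \<in> X \<Longrightarrow> finite (M y x)" using finN by (auto simp: M_def)
    have less_M: "(\<Sum>x\<in>X. card (M y x)) < (\<Sum>x\<in>X. card (N x))" if "y \<in> N x0" for y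
    proof (rule sum_strict_mono_ex1[OF fin])
      show "\<forall>x\<in>X. card (M y x) \<le> card (N x)" by (auto simp: M_def intro: card_mono finN)
      show "\<exists>x\<in>X. card (M y x) < card (N x)"
        using x0 that by (intro bexI[of _ x0]) (auto simp: M_def intro!: psubset_card_mono finN)
    qed
    have "\<exists>y\<in>{y1,y2}. \<forall>S\<subseteq>X. card S \<le> card (\<Union>(M y ` S))"
    proof (rule ccontr)
      assume "\<not> ?thesis"
      then obtain T1 T2 where T: "T1 \<subseteq> X" "card T1 > card (\<Union>(M y1 ` T1))"
        "T2 \<subseteq> X" "card T2 > card (\<Union>(M y2 ` T2))" by (auto simp: not_le)
      have inT: "x0 \<in> T" if "T \<subseteq> X" "card T > card (\<Union>(M y ` T))" for T y
      proof (rule ccontr)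
        assume "x0 \<notin> T"
        then have "M y ` T = N ` T" by (auto simp: M_def)
        then show False using hall[OF that(1)] that(2) by simp
      qed
      define S1 S2 where "S1 = T1 - {x0}" and "S2 = T2 - {x0}"
      define A B where "A = \<Union>(M y1 ` T1)" and "B = \<Union>(M y2 ` T2)"
      have TS: "T1 = insert x0 S1" "T2 = insert x0 S2" "x0 \<notin> S1" "x0 \<notin> S2" "S1 \<subseteq> X" "S2 \<subseteq> X"
        using inT T by (auto simp: S1_def S2_def)
      have finS: "finite S1" "finite S2" using TS fin finite_subset by blast+
      have finAB: "finite A" "finite B"
        using T finM fin unfolding A_def B_def by (meson finite_UN_I finite_subset subsetD)+
      have cA: "card A \<le> card S1" and cB: "card B \<le> card S2"
        using T finS TS unfolding A_def B_def by auto
      have M: "M y x = N x" if "x \<noteq> x0" for x y using that by (simp add: M_def)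
      have "\<Union>(N ` insert x0 (S1 \<union> S2)) \<subseteq> A \<union> B"
      proof
        fix v assume "v \<in> \<Union>(N ` insert x0 (S1 \<union> S2))"
        then consider "v \<in> N x0" | x where "x \<in> S1" "v \<in> N x" | x where "x \<in> S2" "v \<in> N x" by auto
        then show "v \<in> A \<union> B"
        proof cases
          case 1
          then have "v \<in> M y1 x0 \<or> v \<in> M y2 x0" using y by (auto simp: M_def)
          then show ?thesis using TS unfolding A_def B_def by auto
        next
          case 2 then show ?thesis using M[of x y1] TS unfolding A_def by fastforce
        next
          case 3 then show ?thesis using M[of x y2] TS unfolding B_def by fastforce
        qed
      qed
      then have 1: "card (insert x0 (S1 \<union> S2)) \<le> card (A \<union> B)"
        using hall[of "insert x0 (S1 \<union> S2)"] TS x0 finAB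
        by (meson Un_least card_mono finite_UnI insert_subset le_trans)
      have "\<Union>(N ` (S1 \<inter> S2)) \<subseteq> A \<inter> B"
      proof
        fix v assume "v \<in> \<Union>(N ` (S1 \<inter> S2))"
        then obtain x where "x \<in> S1" "x \<in> S2" "v \<in> N x" by auto
        then show "v \<in> A \<inter> B" using M[of x y1] M[of x y2] TS unfolding A_def B_def by fastforce
      qed
      then have 2: "card (S1 \<inter> S2) \<le> card (A \<inter> B)"
        using hall[of "S1 \<inter> S2"] TS finAB by (meson card_mono finite_Int inf.coboundedI1 le_trans)
      have "card (A \<union> B) + card (A \<inter> B) = card A + card B" using card_Un_Int[OF finAB] by simp
      moreover have "card (S1 \<union> S2) + card (S1 \<inter> S2) = card S1 + card S2"
        using card_Un_Int[OF finS] by simp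
      moreover have "card (insert x0 (S1 \<union> S2)) = Suc (card (S1 \<union> S2))" using TS finS by simp
      ultimately show False using 1 2 cA cB by linarith
    qed
    then obtain y where yy: "y \<in> N x0" "\<And>S. S \<subseteq> X \<Longrightarrow> card S \<le> card (\<Union>(M y ` S))" using y by auto
    from less.hyps[OF less_M[OF yy(1)] finM yy(2)]
    obtain f where "inj_on f X" "\<forall>x\<in>X. f x \<in> M y x" by auto
    moreover have "M y x \<subseteq> N x" for x by (auto simp: M_def)
    ultimately show ?thesis by blast
  qed
qed

text \<open>Only one element can lie below \<open>c\<close>, and if it does so by \<open>j\<close>, then each of the others exceeds \<open>c\<close>
by at least \<open>j\<close>.\<close>

lemma sum_ge_of_pairs_even:
  fixes d :: "'a \<Rightarrow> nat"
  assumes "finite S" "card S \<ge> 2"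
    and "\<And>u v. u \<in> S \<Longrightarrow> v \<in> S \<Longrightarrow> u \<noteq> v \<Longrightarrow> 2 * c \<le> d u + d v"
  shows "card S * c \<le> sum d S"
proof (cases "\<exists>v\<in>S. d v < c")
  case False
  then show ?thesis using sum_bounded_below[of S c d] by (auto simp: not_less)
next
  case True
  then obtain v where v: "v \<in> S" "d v < c" by auto
  have "card (S - {v}) * (2 * c - d v) \<le> sum d (S - {v})"
  proof -
    have "2 * c - d v \<le> d u" if "u \<in> S - {v}" for u using assms(3)[OF v(1), of u] that by auto
    then have "of_nat (card (S - {v})) * (2 * c - d v) \<le> sum d (S - {v})"
      by (intro sum_bounded_below) auto
    then show ?thesis by simp
  qed
  moreover obtain n where n: "card S = n + 2"
    using assms(2) by (intro that[of "card S - 2"]) simp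
  moreover have "card (S - {v}) = n + 1" using n v assms(1) by simp
  moreover have "sum d S = d v + sum d (S - {v})" using v assms(1) by (simp add: sum.remove)
  moreover obtain j where j: "c = d v + j" "j > 0"
    using v(2) by (intro that[of "c - d v"]) auto
  ultimately have "d v + (n + 1) * (d v + 2 * j) \<le> sum d S" by (simp add: mult_2)
  moreover have "(n + 2) * c \<le> d v + (n + 1) * (d v + 2 * j)" using j by (simp add: algebra_simps)
  ultimately show ?thesis using n by simp
qed

text \<open>Again only one element can lie below \<open>c\<close>; the odd bound \<open>2c - 1\<close> costs one unit in the total
and not one unit per element, however large \<open>S\<close> is.\<close>

lemma sum_ge_of_pairs_odd:
  fixes d :: "'a \<Rightarrow> nat"
  assumes "finite S" "card S \<ge> 2"
    and "\<And>u v. u \<in> S \<Longrightarrow> v \<in> S \<Longrightarrow> u \<noteq> v \<Longrightarrow> 2 * c \<le> d u + d v + 1"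
  shows "card S * c \<le> sum d S + 1"
proof (cases "\<exists>v\<in>S. d v < c")
  case False
  then show ?thesis using sum_bounded_below[of S c d] by (auto simp: not_less le_SucI)
next
  case True
  then obtain v where v: "v \<in> S" "d v < c" by auto
  have "card (S - {v}) * (2 * c - 1 - d v) \<le> sum d (S - {v})"
  proof -
    have "2 * c - 1 - d v \<le> d u" if "u \<in> S - {v}" for u using assms(3)[OF v(1), of u] that by auto
    then have "of_nat (card (S - {v})) * (2 * c - 1 - d v) \<le> sum d (S - {v})"
      by (intro sum_bounded_below) auto
    then show ?thesis by simp
  qed
  moreover obtain n where n: "card S = n + 2"
    using assms(2) by (intro that[of "card S - 2"]) simp
  moreover have "card (S - {v}) = n + 1" using n v assms(1) by simp
  moreover have "sum d S = d v + sum d (S - {v})" using v assms(1) by (simp add: sum.remove)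
  moreover obtain j where j: "c = d v + 1 + j" 
    using v(2) by (intro that[of "c - d v - 1"]) auto
  ultimately have "d v + (n + 1) * (d v + 1 + 2 * j) \<le> sum d S" by (simp add: mult_2)
  moreover have "(n + 2) * c \<le> d v + (n + 1) * (d v + 1 + 2 * j) + 1" using j by (simp add: algebra_simps)
  ultimately show ?thesis using n by simp
qed

lemma iterates_in_invariant:
  "successively (\<lambda>p q. q = f p) xs \<Longrightarrow> xs \<noteq> [] \<Longrightarrow> hd xs \<in> K \<Longrightarrow> f ` K \<subseteq> K \<Longrightarrow> set xs \<subseteq> K"
  by (induction xs rule: induct_list012) auto

lemma subset_of_Un_disjoint: "X \<subseteq> H \<union> Y \<Longrightarrow> X \<inter> Y = {} \<Longrightarrow> X \<subseteq> H"
  by blast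

section \<open>Balanced bipartite digraphs as relations\<close>

definition deg :: "('a \<times> 'a) set \<Rightarrow> 'a \<Rightarrow> nat" where
  "deg A v = card (A `` {v}) + card (A\<inverse> `` {v})"

lemma deg_converse [simp]: "deg (A\<inverse>) v = deg A v"
  by (simp add: deg_def)

text \<open>The arc pattern of \<open>H1_family\<close> with the partite sets as arguments, since either side of a given digraph
can be the one that contains \<open>S\<close>.\<close>

definition H1_shape :: "'a set \<Rightarrow> 'a set \<Rightarrow> ('a \<times> 'a) set \<Rightarrow> nat \<Rightarrow> bool" where
  "H1_shape V1 V2 A a \<longleftrightarrow> odd a \<and> (\<exists>S R U W E.
     V1 = S \<union> R \<and> S \<inter> R = {} \<and> V2 = U \<union> W \<and> U \<inter> W = {} \<and>
     card S = (a + 1) div 2 \<and> card W = (a + 1) div 2 \<and>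
     card U = (a - 1) div 2 \<and> card R = (a - 1) div 2 \<and>
     A = (R \<times> W \<union> W \<times> R) \<union> (U \<times> S \<union> S \<times> U) \<union> W \<times> S \<union> E \<and>
     E \<subseteq> R \<times> U \<union> U \<times> R \<and>
     (\<exists>r\<in>R. \<exists>u\<in>U. (u, r) \<in> E) \<and>
     (\<forall>r\<in>R. card (E \<inter> ({r} \<times> U \<union> U \<times> {r})) \<ge> (a - 3) div 2) \<and>
     (\<forall>u\<in>U. card (E \<inter> ({u} \<times> R \<union> R \<times> {u})) \<ge> (a - 3) div 2))"

definition H2_shape :: "'a set \<Rightarrow> ('a \<times> 'a) set \<Rightarrow> bool" where
  "H2_shape V A \<longleftrightarrow> (\<exists>x1 x2 x3 y1 y2 y3. distinct [x1, x2, x3, y1, y2, y3] \<and> V = {x1, x2, x3, y1, y2, y3} \<and>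
     A = {(x1, y2), (y2, x3), (x3, y3), (y3, x1), (x2, y2), (y2, x2), (x2, y3), (y3, x2),
          (y1, x1), (x1, y1), (y1, x3), (x3, y1)})"

text \<open>Strong connectivity enters only through \<open>cut\<close>: every proper non-empty set of vertices has an
arc leaving it. The locale is symmetric under exchanging the sides and under
reversing all arcs.\<close>

locale meyniel_bipartite =
  fixes V1 V2 :: "'a set" and A :: "('a \<times> 'a) set" and a :: nat
  assumes fin1: "finite V1" and fin2: "finite V2"
    and disj: "V1 \<inter> V2 = {}"
    and card1: "card V1 = a" and card2: "card V2 = a"
    and bip: "A \<subseteq> V1 \<times> V2 \<union> V2 \<times> V1"
    and cut: "\<And>X. X \<subseteq> V1 \<union> V2 \<Longrightarrow> X \<noteq> {} \<Longrightarrow> X \<noteq> V1 \<union> V2 \<Longrightarrow>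
      \<exists>u\<in>X. \<exists>v\<in>(V1 \<union> V2) - X. (u, v) \<in> A"
    and meyniel: "\<And>u v. u \<in> V1 \<union> V2 \<Longrightarrow> v \<in> V1 \<union> V2 \<Longrightarrow> u \<noteq> v \<Longrightarrow> (u, v) \<notin> A \<Longrightarrow> (v, u) \<notin> A \<Longrightarrow>
      3 * a \<le> deg A u + deg A v + 1"
    and a3: "3 \<le> a"
begin

abbreviation V :: "'a set" where "V \<equiv> V1 \<union> V2"

lemma finV: "finite V" using fin1 fin2 by simp

lemma nonempty: "V1 \<noteq> {}" "V2 \<noteq> {}"
proof -
  show "V1 \<noteq> {}" using card1 a3 by (intro notI) simp
  show "V2 \<noteq> {}" using card2 a3 by (intro notI) simp
qed

lemma finA: "finite A" using bip fin1 fin2 by (rule_tac finite_subset) auto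

lemma swap: "meyniel_bipartite V2 V1 A a"
  using fin1 fin2 disj card1 card2 bip cut meyniel a3
  by unfold_locales (auto simp: Un_commute)

lemma reverse: "meyniel_bipartite V1 V2 (A\<inverse>) a"
proof (unfold_locales)
  show "A\<inverse> \<subseteq> V1 \<times> V2 \<union> V2 \<times> V1" using bip by auto
  fix X assume X: "X \<subseteq> V" "X \<noteq> {}" "X \<noteq> V"
  then have "\<exists>u\<in>V - X. \<exists>v\<in>V - (V - X). (u, v) \<in> A" by (intro cut) auto
  then show "\<exists>u\<in>X. \<exists>v\<in>V - X. (u, v) \<in> A\<inverse>" using X by auto
next
  fix u v assume "u \<in> V" "v \<in> V" "u \<noteq> v" "(u, v) \<notin> A\<inverse>" "(v, u) \<notin> A\<inverse>"
  then show "3 * a \<le> deg (A\<inverse>) u + deg (A\<inverse>) v + 1" using meyniel[of u v] by simp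
qed (use fin1 fin2 disj card1 card2 a3 in auto)

lemma out_sub: "v \<in> V1 \<Longrightarrow> A `` {v} \<subseteq> V2" and in_sub: "v \<in> V1 \<Longrightarrow> A\<inverse> `` {v} \<subseteq> V2"
  using bip disj by auto

lemma arc_sides: "(u, v) \<in> A \<Longrightarrow> u \<in> V1 \<and> v \<in> V2 \<or> u \<in> V2 \<and> v \<in> V1"
  using bip by auto

lemma same_side: "u \<in> V1 \<Longrightarrow> v \<in> V1 \<Longrightarrow> (u, v) \<notin> A" "u \<in> V2 \<Longrightarrow> v \<in> V2 \<Longrightarrow> (u, v) \<notin> A"
  using bip disj by auto

lemma meyniel1: "u \<in> V1 \<Longrightarrow> v \<in> V1 \<Longrightarrow> u \<noteq> v \<Longrightarrow> 3 * a \<le> deg A u + deg A v + 1"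
  using meyniel same_side by blast

lemma meyniel2: "u \<in> V2 \<Longrightarrow> v \<in> V2 \<Longrightarrow> u \<noteq> v \<Longrightarrow> 3 * a \<le> deg A u + deg A v + 1"
  using meyniel same_side by blast

section \<open>Perfect matchings and the first exceptional family\<close>

text \<open>Each vertex of \<open>S\<close> has degree at most \<open>2a - |W|\<close>. Two of them must reach \<open>3a - 1\<close>, which bounds
\<open>|W|\<close>; when the bound is attained, every vertex of \<open>S\<close> has all arcs that \<open>S \<times> W \<inter> A = {}\<close> permits.\<close>

lemma blocked_bound:
  assumes "S \<subseteq> V1" "W \<subseteq> V2" "S \<times> W \<inter> A = {}" "2 \<le> card S"
  shows "2 * card W \<le> a + 1"
    and "2 * card W = a + 1 \<Longrightarrow> s \<in> S \<Longrightarrow> A `` {s} = V2 - W \<and> A\<inverse> `` {s} = V2"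
proof -
  have finS: "finite S" using assms(1) fin1 finite_subset by blast
  have out: "A `` {s} \<subseteq> V2 - W" if "s \<in> S" for s using that out_sub[of s] assms by auto
  have inn: "A\<inverse> `` {s} \<subseteq> V2" if "s \<in> S" for s using that in_sub[of s] assms by auto
  have cW: "card (V2 - W) = a - card W" "card W \<le> a"
    using card2 fin2 assms(2) card_mono[OF fin2 assms(2)]
    by (auto simp: card_Diff_subset[OF finite_subset[OF assms(2) fin2] assms(2)])
  have le_out: "card (A `` {s}) \<le> a - card W" if "s \<in> S" for s
    using card_mono[OF _ out[OF that]] fin2 cW by simp
  have le_in: "card (A\<inverse> `` {s}) \<le> a" if "s \<in> S" for s
    using card_mono[OF _ inn[OF that]] fin2 card2 by simp
  obtain s1 s2 where st: "s1 \<in> S" "s2 \<in> S" "s1 \<noteq> s2"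
    using assms(4) card_le_Suc0_iff_eq[OF finS] by fastforce
  have "3 * a \<le> deg A s1 + deg A s2 + 1" using meyniel1[of s1 s2] st assms by auto
  then show "2 * card W \<le> a + 1"
    using le_out[OF st(1)] le_out[OF st(2)] le_in[OF st(1)] le_in[OF st(2)] cW(2)
    unfolding deg_def by linarith
  assume W: "2 * card W = a + 1" and s: "s \<in> S"
  obtain t where t: "t \<in> S" "t \<noteq> s" using st by metis
  have "3 * a \<le> deg A s + deg A t + 1" using meyniel1[of s t] s t assms by auto
  then have "card (A `` {s}) = card (V2 - W)" "card (A\<inverse> `` {s}) = card V2"
    using le_out[OF s] le_out[OF t(1)] le_in[OF s] le_in[OF t(1)] cW W card2
    unfolding deg_def by linarith+
  then show "A `` {s} = V2 - W \<and> A\<inverse> `` {s} = V2"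
    using out[OF s] inn[OF s] fin2 by (meson card_subset_eq finite_Diff)
qed

text \<open>The vertex \<open>s\<close> has degree exactly \<open>(3a - 1) / 2\<close>, so \<open>r\<close> has at least that degree; the \<open>a + 1\<close> arcs
between \<open>r\<close> and \<open>W\<close> leave at least \<open>(a - 3) / 2\<close> for \<open>U\<close>.\<close>

lemma tight_degree:
  assumes "W \<subseteq> V2" "U = V2 - W" "2 * card W = a + 1"
    and "s \<in> V1" "A `` {s} = U" "A\<inverse> `` {s} = V2"
    and "r \<in> V1" "r \<noteq> s" "W \<subseteq> A `` {r}" "W \<subseteq> A\<inverse> `` {r}"
  shows "(a - 3) div 2 \<le> card (A \<inter> ({r} \<times> U \<union> U \<times> {r}))"
proof -
  have finU: "finite U" and finW: "finite W" using assms fin2 finite_subset by auto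
  have cU: "card U + card W = a"
    using card2 card_mono[OF fin2 assms(1)] card_Diff_subset[OF finW assms(1)] assms(2) by simp
  have 1: "card (A `` {r}) = card (A `` {r} \<inter> U) + card W"
  proof -
    have "A `` {r} = (A `` {r} \<inter> U) \<union> W" using out_sub[of r] assms by auto
    then show ?thesis using card_Un_disjoint[of "A `` {r} \<inter> U" W] finU finW assms(2) by auto
  qed
  have 2: "card (A\<inverse> `` {r}) = card (A\<inverse> `` {r} \<inter> U) + card W"
  proof -
    have "A\<inverse> `` {r} = (A\<inverse> `` {r} \<inter> U) \<union> W" using in_sub[of r] assms by auto
    then show ?thesis using card_Un_disjoint[of "A\<inverse> `` {r} \<inter> U" W] finU finW assms(2) by auto
  qed
  have "A \<inter> ({r} \<times> U \<union> U \<times> {r}) = Pair r ` (A `` {r} \<inter> U) \<union> (\<lambda>u. (u, r)) ` (A\<inverse> `` {r} \<inter> U)" by auto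
  moreover have "card (Pair r ` (A `` {r} \<inter> U) \<union> (\<lambda>u. (u, r)) ` (A\<inverse> `` {r} \<inter> U))
      = card (Pair r ` (A `` {r} \<inter> U)) + card ((\<lambda>u. (u, r)) ` (A\<inverse> `` {r} \<inter> U))"
  proof (rule card_Un_disjoint)
    show "Pair r ` (A `` {r} \<inter> U) \<inter> (\<lambda>u. (u, r)) ` (A\<inverse> `` {r} \<inter> U) = {}"
      using assms disj by auto
  qed (use finU in auto)
  ultimately have 3: "card (A \<inter> ({r} \<times> U \<union> U \<times> {r})) = card (A `` {r} \<inter> U) + card (A\<inverse> `` {r} \<inter> U)"
    by (simp add: card_image inj_on_def)
  have "deg A s = card U + a" using assms card2 by (simp add: deg_def)
  moreover have "3 * a \<le> deg A s + deg A r + 1" using meyniel1[of s r] assms by auto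
  ultimately show ?thesis using 1 2 3 cU assms(3) unfolding deg_def by linarith
qed

text \<open>A violation \<open>S\<close> of Hall's condition and the set \<open>W\<close> of vertices not dominated by \<open>S\<close> satisfy
\<open>|S| + |W| \<ge> a + 1\<close>. Strong connectivity rules out that one of them is a single vertex, so
\<open>blocked_bound\<close> applies to \<open>S\<close> and, in the reversed digraph, to \<open>W\<close>, and both bounds are attained.\<close>

lemma matching_or_H1_shape:
  "(\<exists>g. bij_betw g V1 V2 \<and> (\<forall>v\<in>V1. (v, g v) \<in> A)) \<or> H1_shape V1 V2 A a"
proof (cases "\<forall>S\<subseteq>V1. card S \<le> card (\<Union>v\<in>S. A `` {v})")
  case True
  have "\<exists>g. inj_on g V1 \<and> (\<forall>v\<in>V1. g v \<in> A `` {v})"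
    by (rule hall_marriage[OF fin1]) (use True finA in \<open>auto intro: finite_Image\<close>)
  then obtain g where g: "inj_on g V1" "\<forall>v\<in>V1. g v \<in> A `` {v}" by auto
  then have "g ` V1 \<subseteq> V2" using out_sub by auto
  then have "g ` V1 = V2" using card_image[OF g(1)] card1 card2 fin2 by (metis card_subset_eq)
  then have "bij_betw g V1 V2 \<and> (\<forall>v\<in>V1. (v, g v) \<in> A)" using g by (auto simp: bij_betw_def)
  then show ?thesis by blast
next
  case False
  then obtain S where S: "S \<subseteq> V1" "\<not> card S \<le> card (\<Union>v\<in>S. A `` {v})" by blast
  moreover have "(\<Union>v\<in>S. A `` {v}) = A `` S" by auto
  ultimately have S: "S \<subseteq> V1" "card S > card (A `` S)" by auto
  define R W U where "R = V1 - S" and "W = V2 - A `` S" and "U = V2 - W"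
  have AS: "A `` S \<subseteq> V2" using out_sub S(1) by auto
  have UA: "U = A `` S" unfolding U_def W_def using AS by auto
  have finS: "finite S" and finW: "finite W" and finR: "finite R" and finU: "finite U"
    using S(1) fin1 fin2 finite_subset unfolding R_def W_def U_def by auto
  have SW: "S \<times> W \<inter> A = {}" by (auto simp: W_def)
  have cSR: "card S + card R = a" unfolding R_def
    using card1 card_mono[OF fin1 S(1)] card_Diff_subset[OF finS S(1)] by simp
  have cUW: "card U + card W = a" unfolding W_def UA
    using card2 card_mono[OF fin2 AS] card_Diff_subset[OF finite_subset[OF AS fin2] AS] by simp
  have SWa: "card S + card W \<ge> a + 1" using S(2) cUW UA by simp
  have S2: "2 \<le> card S"
  proof (rule ccontr)
    assume "\<not> 2 \<le> card S"
    then have c: "card S = 1" "card U = 0" using SWa cUW S(2) by linarith+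
    then have "A `` S = {}" using UA finU by simp
    have "S \<noteq> {}" using c(1) by (intro notI) simp
    moreover have "S \<noteq> V" using S(1) disj nonempty by blast
    ultimately have "\<exists>u\<in>S. \<exists>v\<in>V - S. (u, v) \<in> A" using S(1) by (intro cut) auto
    then show False using \<open>A `` S = {}\<close> by auto
  qed
  have W2: "2 \<le> card W"
  proof (rule ccontr)
    assume "\<not> 2 \<le> card W"
    then have c: "card W = 1" "card R = 0" using SWa cSR cUW S(2) card_mono[OF fin1 S(1)] card1 by linarith+
    have "R = {}" using c(2) finR by simp
    then have "S = V1" unfolding R_def using S(1) by auto
    have "W \<noteq> {}" using c(1) by (intro notI) simp
    have "W \<subseteq> V2" by (auto simp: W_def)
    have "\<exists>u\<in>V - W. \<exists>v\<in>V - (V - W). (u, v) \<in> A"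
    proof (rule cut)
      show "V - W \<noteq> {}" using nonempty(1) disj \<open>W \<subseteq> V2\<close> by blast
      show "V - W \<noteq> V" using \<open>W \<noteq> {}\<close> \<open>W \<subseteq> V2\<close> by blast
    qed blast
    then obtain u v where uv: "u \<in> V - W" "v \<in> W" "(u, v) \<in> A" by blast
    then have "u \<in> S" using arc_sides[OF uv(3)] \<open>S = V1\<close> \<open>W \<subseteq> V2\<close> disj by blast
    then show False using SW uv by blast
  qed
  interpret rs: meyniel_bipartite V2 V1 "A\<inverse>" a
    by (rule meyniel_bipartite.swap[OF reverse])
  have WV: "W \<subseteq> V2" by (auto simp: W_def)
  have WS: "W \<times> S \<inter> A\<inverse> = {}" using SW by auto
  note bW = blocked_bound[OF S(1) WV SW S2]
  note bS = rs.blocked_bound[OF WV S(1) WS W2]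
  have cS: "2 * card S = a + 1" and cW: "2 * card W = a + 1" using bW(1) bS(1) SWa by linarith+
  have s: "A `` {s} = U" "A\<inverse> `` {s} = V2" if "s \<in> S" for s using bW(2)[OF cW that] by (auto simp: U_def)
  have w: "A\<inverse> `` {w} = R" "A `` {w} = V1" if "w \<in> W" for w using bS(2)[OF cS that] by (auto simp: R_def)
  have oddA: "odd a" using cS by (metis even_Suc Suc_eq_plus1 dvd_triv_left)
  obtain s0 w0 where sw0: "s0 \<in> S" "w0 \<in> W" using S2 W2 by fastforce
  define E where "E = A \<inter> (R \<times> U \<union> U \<times> R)"
  have V: "V1 = S \<union> R" "S \<inter> R = {}" "V2 = U \<union> W" "U \<inter> W = {}"
    using S(1) WV by (auto simp: R_def U_def)
  have eqA: "A = (R \<times> W \<union> W \<times> R) \<union> (U \<times> S \<union> S \<times> U) \<union> W \<times> S \<union> E"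
  proof (rule set_eqI, clarify)
    fix p q
    show "(p, q) \<in> A \<longleftrightarrow> (p, q) \<in> (R \<times> W \<union> W \<times> R) \<union> (U \<times> S \<union> S \<times> U) \<union> W \<times> S \<union> E"
    proof
      assume pq: "(p, q) \<in> A"
      then show "(p, q) \<in> (R \<times> W \<union> W \<times> R) \<union> (U \<times> S \<union> S \<times> U) \<union> W \<times> S \<union> E"
        using arc_sides[OF pq] V SW by (auto simp: E_def)
    next
      assume pq: "(p, q) \<in> (R \<times> W \<union> W \<times> R) \<union> (U \<times> S \<union> S \<times> U) \<union> W \<times> S \<union> E"
      have "(p, q) \<in> A" if "p \<in> R" "q \<in> W" using w(1)[OF that(2)] that by auto
      moreover have "(p, q) \<in> A" if "p \<in> W" "q \<in> V1" using w(2)[OF that(1)] that by auto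
      moreover have "(p, q) \<in> A" if "p \<in> S" "q \<in> U" using s(1)[OF that(1)] that by auto
      moreover have "(p, q) \<in> A" if "p \<in> V2" "q \<in> S" using s(2)[OF that(2)] that by auto
      ultimately show "(p, q) \<in> A" using pq V by (auto simp: E_def)
    qed
  qed
  have "\<exists>x\<in>S \<union> U. \<exists>y\<in>V - (S \<union> U). (x, y) \<in> A"
  proof (rule cut)
    have "w0 \<notin> S" "w0 \<notin> U" using sw0(2) V disj by blast+
    then show "S \<union> U \<noteq> V" using sw0(2) WV by blast
  qed (use V sw0(1) in blast)+
  then obtain x y where xy: "x \<in> S \<union> U" "y \<in> V - (S \<union> U)" "(x, y) \<in> A" by blast
  then have "y \<in> R \<union> W" using V by blast
  then have "x \<in> U \<and> y \<in> R" using arc_sides[OF xy(3)] xy SW V disj by blast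
  then have ur: "\<exists>r\<in>R. \<exists>u\<in>U. (u, r) \<in> E" using xy(3) unfolding E_def by blast
  have r: "(a - 3) div 2 \<le> card (E \<inter> ({r} \<times> U \<union> U \<times> {r}))" if "r \<in> R" for r
  proof -
    have "E \<inter> ({r} \<times> U \<union> U \<times> {r}) = A \<inter> ({r} \<times> U \<union> U \<times> {r})" using that by (auto simp: E_def)
    moreover have "(a - 3) div 2 \<le> card (A \<inter> ({r} \<times> U \<union> U \<times> {r}))"
    proof (rule tight_degree[OF WV U_def cW, of s0])
      show "s0 \<in> V1" "r \<in> V1" "r \<noteq> s0" using that sw0 V by blast+
      show "W \<subseteq> A `` {r}" using w(1) that by blast
      show "W \<subseteq> A\<inverse> `` {r}" using w(2) that V(1) by blast
    qed (use s[OF sw0(1)] in simp_all)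
    ultimately show ?thesis by simp
  qed
  have u: "(a - 3) div 2 \<le> card (E \<inter> ({u} \<times> R \<union> R \<times> {u}))" if "u \<in> U" for u
  proof -
    have "E \<inter> ({u} \<times> R \<union> R \<times> {u}) = (A\<inverse> \<inter> ({u} \<times> R \<union> R \<times> {u}))\<inverse>" using that by (auto simp: E_def)
    moreover have "(a - 3) div 2 \<le> card (A\<inverse> \<inter> ({u} \<times> R \<union> R \<times> {u}))"
    proof (rule rs.tight_degree[OF S(1) R_def cS, of w0])
      show "w0 \<in> V2" "u \<in> V2" "u \<noteq> w0" using that sw0 V by blast+
      show "S \<subseteq> A\<inverse> `` {u}" using s(1) that by blast
      show "S \<subseteq> (A\<inverse>)\<inverse> `` {u}" using s(2) that V(3) by blast
    qed (use w[OF sw0(2)] in simp_all)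
    ultimately show ?thesis by simp
  qed
  have cards: "card S = (a + 1) div 2" "card W = (a + 1) div 2"
    "card U = (a - 1) div 2" "card R = (a - 1) div 2"
    using cS cW cSR cUW by linarith+
  have EE: "E \<subseteq> R \<times> U \<union> U \<times> R" unfolding E_def by blast
  have rr: "\<forall>r\<in>R. (a - 3) div 2 \<le> card (E \<inter> ({r} \<times> U \<union> U \<times> {r}))"
    and uu: "\<forall>u\<in>U. (a - 3) div 2 \<le> card (E \<inter> ({u} \<times> R \<union> R \<times> {u}))"
    using r u by blast+
  have "H1_shape V1 V2 A a"
    unfolding H1_shape_def
    by (rule conjI[OF oddA], rule exI[of _ S], rule exI[of _ R], rule exI[of _ U], rule exI[of _ W],
        rule exI[of _ E], intro conjI) (fact V cards eqA EE ur rr uu)+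
  then show ?thesis by (rule disjI2)
qed

definition factor :: "('a \<Rightarrow> 'a) \<Rightarrow> bool" where
  "factor f \<longleftrightarrow> bij_betw f V V \<and> (\<forall>v\<in>V. (v, f v) \<in> A)"

lemma factor_or_H1_shape:
  "(\<exists>f. factor f) \<or> H1_shape V1 V2 A a \<or> H1_shape V2 V1 A a"
proof -
  interpret sw: meyniel_bipartite V2 V1 A a by (rule swap)
  show ?thesis
  proof (cases "H1_shape V1 V2 A a \<or> H1_shape V2 V1 A a")
    case False
    then obtain g h where g: "bij_betw g V1 V2" "\<forall>v\<in>V1. (v, g v) \<in> A"
      and h: "bij_betw h V2 V1" "\<forall>v\<in>V2. (v, h v) \<in> A"
      using matching_or_H1_shape sw.matching_or_H1_shape by blast
    define f where "f = (\<lambda>v. if v \<in> V1 then g v else h v)"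
    have "bij_betw f V1 V2" using g(1) by (rule bij_betw_cong[THEN iffD1, rotated]) (simp add: f_def)
    moreover have "bij_betw f V2 V1" using h(1)
      by (rule bij_betw_cong[THEN iffD1, rotated]) (use disj in \<open>auto simp: f_def\<close>)
    ultimately have "bij_betw f (V1 \<union> V2) (V2 \<union> V1)" using disj by (intro bij_betw_combine) auto
    then have "factor f" using g h by (auto simp: factor_def f_def Un_commute)
    then show ?thesis by auto
  qed auto
qed

section \<open>Cycle factors with a maximal orbit relation\<close>

definition invariant :: "('a \<Rightarrow> 'a) \<Rightarrow> 'a set \<Rightarrow> bool" where
  "invariant f K \<longleftrightarrow> K \<subseteq> V \<and> f ` K \<subseteq> K"

lemma factor_inj: "factor f \<Longrightarrow> u \<in> V \<Longrightarrow> v \<in> V \<Longrightarrow> f u = f v \<Longrightarrow> u = v"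
  unfolding factor_def bij_betw_def by (blast dest: inj_onD)

lemma factor_arc: "factor f \<Longrightarrow> v \<in> V \<Longrightarrow> (v, f v) \<in> A"
  unfolding factor_def by blast

lemma factor_V: "factor f \<Longrightarrow> v \<in> V \<Longrightarrow> f v \<in> V"
  unfolding factor_def bij_betw_def by blast

lemma factor_sides:
  assumes "factor f"
  shows "v \<in> V1 \<Longrightarrow> f v \<in> V2" "v \<in> V2 \<Longrightarrow> f v \<in> V1"
  using factor_arc[OF assms, of v] arc_sides[of v "f v"] disj by blast+

lemma factorI:
  assumes "inj_on f V" and "\<And>v. v \<in> V \<Longrightarrow> (v, f v) \<in> A"
  shows "factor f"
proof -
  have "f ` V \<subseteq> V" using assms(2) arc_sides by blast
  then have "f ` V = V" using endo_inj_surj[OF finV] assms(1) by blast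
  then show ?thesis using assms by (simp add: factor_def bij_betw_def)
qed

lemma factor_onto:
  assumes "factor f" "v \<in> V"
  obtains u where "u \<in> V" "f u = v"
proof -
  have "v \<in> f ` V" using assms unfolding factor_def bij_betw_def by blast
  then show ?thesis using that by blast
qed

text \<open>An injective map that sends a finite set into itself permutes it, so nothing enters it from outside.\<close>

lemma invariant_back:
  assumes f: "factor f" and K: "K \<subseteq> V" "f ` K \<subseteq> K" and v: "v \<in> V" "f v \<in> K"
  shows "v \<in> K"
proof -
  have "inj_on f K" using f K(1) unfolding factor_def bij_betw_def by (blast intro: inj_on_subset)
  then have "f ` K = K" using K endo_inj_surj finite_subset[OF K(1) finV] by blast
  then obtain u where "u \<in> K" "f u = f v" using v(2) by (metis imageE)
  then show ?thesis using factor_inj[OF f] v(1) K(1) by blast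
qed

lemma invariant_compl:
  assumes "factor f" "invariant f K"
  shows "invariant f (V - K)"
  unfolding invariant_def
proof (intro conjI subsetI)
  fix w assume "w \<in> f ` (V - K)"
  then obtain v where v: "v \<in> V" "v \<notin> K" "w = f v" by blast
  then show "w \<in> V - K"
    using factor_V[OF assms(1) v(1)] invariant_back[OF assms(1)] assms(2) unfolding invariant_def by blast
qed blast

lemma invariant_half:
  assumes "factor f" "invariant f K"
  shows "card (K \<inter> V1) = card (K \<inter> V2)"
proof -
  have fK: "finite (K \<inter> V1)" "finite (K \<inter> V2)" using fin1 fin2 by auto
  have inj: "inj_on f (K \<inter> V1)" "inj_on f (K \<inter> V2)"
    using assms(1) unfolding factor_def bij_betw_def by (blast intro: inj_on_subset)+
  have 1: "f ` (K \<inter> V1) \<subseteq> K \<inter> V2" and 2: "f ` (K \<inter> V2) \<subseteq> K \<inter> V1"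
    using factor_sides[OF assms(1)] assms(2) unfolding invariant_def by blast+
  show ?thesis using card_inj_on_le[OF inj(1) 1 fK(2)] card_inj_on_le[OF inj(2) 2 fK(1)] by linarith
qed

text \<open>The orbit relation of \<open>f\<close>. Its cardinality measures how far the cycles of a factor have been merged;
it is easier to compare than the number of orbits, since a merge makes the relation grow.\<close>

definition reach :: "('a \<Rightarrow> 'a) \<Rightarrow> ('a \<times> 'a) set" where
  "reach f = {(v, f v) |v. v \<in> V}\<^sup>* \<inter> V \<times> V"

definition optimal :: "('a \<Rightarrow> 'a) \<Rightarrow> bool" where
  "optimal f \<longleftrightarrow> factor f \<and> (\<forall>g. factor g \<longrightarrow> card (reach g) \<le> card (reach f))"

lemma finite_reach: "finite (reach f)"
  unfolding reach_def by (rule finite_subset[OF Int_lower2 finite_cartesian_product[OF finV finV]])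

lemma optimal_exists:
  assumes "factor f"
  shows "\<exists>g. optimal g"
proof -
  have "card (reach g) \<le> card (V \<times> V)" for g
    unfolding reach_def by (rule card_mono[OF finite_cartesian_product[OF finV finV] Int_lower2])
  then have "\<forall>g. factor g \<longrightarrow> card (reach g) < Suc (card (V \<times> V))" by (simp add: less_Suc_eq_le)
  from ex_has_greatest_nat[of factor f "\<lambda>g. card (reach g)", OF assms this]
  show ?thesis unfolding optimal_def .
qed

text \<open>Exchanging the images of \<open>u\<close> and \<open>z\<close> joins their two cycles: from \<open>u\<close> the new map goes to \<open>f z\<close>,
follows the old cycle to \<open>z\<close>, then goes to \<open>f u\<close> and back to \<open>u\<close>. That it does reach \<open>z\<close>
from \<open>f z\<close> follows because the points met on the way would otherwise form a set that is
invariant under \<open>f\<close>, contains \<open>f z\<close>, and omits \<open>z\<close>.\<close>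

lemma exchange_enlarges_reach:
  assumes f: "factor f" and K: "invariant f K" and u: "u \<in> K" and z: "z \<in> V" "z \<notin> K"
    and arcs: "(u, f z) \<in> A" "(z, f u) \<in> A"
  shows "\<exists>g. factor g \<and> card (reach f) < card (reach g)"
proof -
  define g where "g = f(u := f z, z := f u)"
  have uV: "u \<in> V" using u K by (auto simp: invariant_def)
  have uz: "u \<noteq> z" using u z by blast
  have g: "g u = f z" "g z = f u" "\<And>v. v \<noteq> u \<Longrightarrow> v \<noteq> z \<Longrightarrow> g v = f v"
    using uz by (auto simp: g_def)
  have inj: "inj_on g V"
  proof (rule inj_onI)
    fix v w assume vw: "v \<in> V" "w \<in> V" "g v = g w"
    define t where "t = (\<lambda>v. if v = u then z else if v = z then u else v)"
    have gt: "g p = f (t p)" and tV: "p \<in> V \<Longrightarrow> t p \<in> V" for p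
      using uV z(1) by (auto simp: t_def g_def)
    have "t v = t w" by (rule factor_inj[OF f]) (use vw gt tV in simp_all)
    then show "v = w" by (simp add: t_def split: if_splits)
  qed
  have facg: "factor g"
  proof (rule factorI[OF inj])
    fix v assume "v \<in> V"
    then show "(v, g v) \<in> A" using g arcs factor_arc[OF f, of v] by (cases "v = u"; cases "v = z") simp_all
  qed
  let ?F = "{(v, f v) |v. v \<in> V}" and ?G = "{(v, g v) |v. v \<in> V}"
  have G: "(v, g v) \<in> ?G" if "v \<in> V" for v using that by blast
  have ret: "(f p, p) \<in> ?G\<^sup>*"
    if p: "p \<in> {u, z}" "p \<in> L" and q: "q \<in> {u, z}" "q \<notin> L" and L: "invariant f L" for p q L
  proof (rule ccontr)
    assume n: "(f p, p) \<notin> ?G\<^sup>*"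
    \<comment> \<open>The points that the new map reaches from \<open>f p\<close> within \<open>L\<close>: there it agrees with \<open>f\<close> away from \<open>p\<close>.\<close>
    define X where "X = {v. (f p, v) \<in> ?G\<^sup>*} \<inter> L"
    have "f ` X \<subseteq> X"
    proof
      fix w assume "w \<in> f ` X"
      then obtain v where v: "v \<in> X" "w = f v" by blast
      have "v \<noteq> p" "v \<noteq> q" "v \<in> V" using v n q L by (auto simp: X_def invariant_def)
      then have "g v = f v" using g(3) p q by blast
      then have "(v, f v) \<in> ?G" using G[OF \<open>v \<in> V\<close>] by simp
      then have "(f p, f v) \<in> ?G\<^sup>*" using v by (auto simp: X_def intro: rtrancl_into_rtrancl)
      then show "w \<in> X" using v L by (auto simp: X_def invariant_def)
    qed
    moreover have "X \<subseteq> V" "p \<in> V" "f p \<in> X" using L p by (auto simp: X_def invariant_def)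
    ultimately have "p \<in> X" using invariant_back[OF f] by blast
    then show False using n by (auto simp: X_def)
  qed
  have bu: "(f u, u) \<in> ?G\<^sup>*" by (rule ret[OF insertI1 u _ z(2) K]) simp
  have bz: "(f z, z) \<in> ?G\<^sup>*"
    by (rule ret[of z "V - K" u, OF _ _ _ _ invariant_compl[OF f K]]) (use u z in blast)+
  have "(u, f z) \<in> ?G\<^sup>*" using G[OF uV] g(1) by auto
  then have uz': "(u, z) \<in> ?G\<^sup>*" using bz by (rule rtrancl_trans)
  have "(z, f u) \<in> ?G\<^sup>*" using G[OF z(1)] g(2) by auto
  then have zu': "(z, u) \<in> ?G\<^sup>*" using bu by (rule rtrancl_trans)
  have "(v, f v) \<in> ?G\<^sup>*" if "v \<in> V" for v
  proof -
    consider "v = u" | "v = z" | "v \<noteq> u" "v \<noteq> z" by blast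
    then show ?thesis
    proof cases
      case 1 then show ?thesis using rtrancl_trans[OF uz' \<open>(z, f u) \<in> ?G\<^sup>*\<close>] by simp
    next
      case 2 then show ?thesis using rtrancl_trans[OF zu' \<open>(u, f z) \<in> ?G\<^sup>*\<close>] by simp
    next
      case 3 then show ?thesis using G[OF that] g(3)[of v] by auto
    qed
  qed
  then have "?F \<subseteq> ?G\<^sup>*" by blast
  then have "?F\<^sup>* \<subseteq> ?G\<^sup>*" using rtrancl_subset_rtrancl by blast
  moreover have "v \<in> K" if "(u, v) \<in> ?F\<^sup>*" for v
    using that by induction (use u K in \<open>auto simp: invariant_def\<close>)
  then have "(u, z) \<notin> ?F\<^sup>*" using z by blast
  ultimately have "reach f \<subset> reach g" unfolding reach_def using uz' uV z(1) by blast
  then show ?thesis using facg psubset_card_mono[OF finite_reach] by blast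
qed

lemma optimal_factor: "optimal f \<Longrightarrow> factor f"
  by (simp add: optimal_def)

lemma optimal_no_exchange:
  assumes "optimal f" "invariant f K" "u \<in> K" "z \<in> V" "z \<notin> K" "(u, f z) \<in> A"
  shows "(z, f u) \<notin> A"
  using exchange_enlarges_reach[of f K u z] assms unfolding optimal_def
  by (meson not_less)

section \<open>Degree sums over unions of orbits\<close>

definition missing :: "'a set \<Rightarrow> ('a \<times> 'a) set" where
  "missing K = ((K \<inter> V1) \<times> (K \<inter> V2) \<union> (K \<inter> V2) \<times> (K \<inter> V1)) - A"

text \<open>Each possible arc between \<open>K\<close> and its complement belongs to exactly one pair \<open>(u, z)\<close> on one side
with \<open>u \<in> K\<close> and \<open>z \<notin> K\<close>, as \<open>u \<rightarrow> f z\<close> or as \<open>z \<rightarrow> f u\<close>. For an optimal factor each pair contributes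
at most one arc; the gaps are the pairs that contribute none.\<close>

definition gaps :: "('a \<Rightarrow> 'a) \<Rightarrow> 'a set \<Rightarrow> ('a \<times> 'a) set" where
  "gaps f K = {(u, z) \<in> (K \<inter> V1) \<times> (V1 - K) \<union> (K \<inter> V2) \<times> (V2 - K). (u, f z) \<notin> A \<and> (z, f u) \<notin> A}"

lemma degree_sum_arcs:
  assumes "K \<subseteq> V"
  shows "(\<Sum>v\<in>K. deg A v) = card (A \<inter> K \<times> UNIV) + card (A\<inverse> \<inter> K \<times> UNIV)"
proof -
  have finK: "finite K" using assms finV finite_subset by blast
  have "(\<Sum>v\<in>K. card (B `` {v})) = card (B \<inter> K \<times> UNIV)" if "finite B" for B :: "('a \<times> 'a) set"
  proof -
    have "(SIGMA v:K. B `` {v}) = B \<inter> K \<times> UNIV" by auto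
    then show ?thesis using card_SigmaI[OF finK, of "\<lambda>v. B `` {v}"] that finite_Image by metis
  qed
  then show ?thesis using finA by (simp add: deg_def sum.distrib)
qed

text \<open>Inside \<open>K\<close> there are \<open>2m\<^sup>2\<close> possible arcs, each counted at both ends. The arcs between \<open>K\<close> and its
complement are counted by the \<open>2m(a - m)\<close> pairs on one side, and by optimality no pair counts twice.\<close>

lemma degree_count:
  assumes f: "optimal f" and K: "invariant f K" and m: "card (K \<inter> V1) = m"
  shows "(\<Sum>v\<in>K. deg A v) + 2 * card (missing K) + card (gaps f K) = 2 * m * (a + m)"
proof -
  note fac = optimal_factor[OF f]
  have KV: "K \<subseteq> V" and fK: "f ` K \<subseteq> K" using K by (auto simp: invariant_def)
  have m2: "card (K \<inter> V2) = m" using invariant_half[OF fac K] m by simp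
  have finK: "finite K" using KV finV finite_subset by blast
  have LV: "V - K \<subseteq> V" and fL: "f ` (V - K) \<subseteq> V - K"
    using invariant_compl[OF fac K] by (auto simp: invariant_def)
  define F where "F = (K \<inter> V1) \<times> (K \<inter> V2) \<union> (K \<inter> V2) \<times> (K \<inter> V1)"
  define I where "I = A \<inter> K \<times> K"
  define G where "G = (K \<inter> V1) \<times> (V1 - K) \<union> (K \<inter> V2) \<times> (V2 - K)"
  define X where "X = {(u, z) \<in> G. (u, f z) \<in> A}"
  define Y where "Y = {(u, z) \<in> G. (z, f u) \<in> A}"
  have finFG: "finite F" "finite G" using finK fin1 fin2 by (auto simp: F_def G_def)
  have finXY: "finite X" "finite Y" using finFG(2) by (auto simp: X_def Y_def intro: finite_subset)
  have cF: "card F = 2 * (m * m)"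
  proof -
    have "card F = card ((K \<inter> V1) \<times> (K \<inter> V2)) + card ((K \<inter> V2) \<times> (K \<inter> V1))"
      unfolding F_def using finK disj by (intro card_Un_disjoint) auto
    then show ?thesis using m m2 by (simp add: card_cartesian_product)
  qed
  have d1: "card (V1 - K) = a - m"
    using card_Diff_subset_Int[of V1 K] fin1 card1 m by (simp add: Int_commute)
  have d2: "card (V2 - K) = a - m"
    using card_Diff_subset_Int[of V2 K] fin2 card2 m2 by (simp add: Int_commute)
  have cG: "card G = 2 * (m * (a - m))"
  proof -
    have "card G = card ((K \<inter> V1) \<times> (V1 - K)) + card ((K \<inter> V2) \<times> (V2 - K))"
      unfolding G_def using finK fin1 fin2 disj by (intro card_Un_disjoint) auto
    then show ?thesis using m m2 d1 d2 by (simp add: card_cartesian_product)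
  qed
  have ma: "m \<le> a" using card_mono[OF fin1, of "K \<inter> V1"] m card1 by simp
  have IF: "I \<subseteq> F" using arc_sides by (auto simp: I_def F_def)
  have finI: "finite I" using IF finFG(1) finite_subset by blast
  have "missing K = F - I" by (auto simp: missing_def F_def I_def)
  then have miss: "card (missing K) + card I = 2 * (m * m)"
    using card_Diff_subset[OF finI IF] card_mono[OF finFG(1) IF] cF by simp
  have gap: "gaps f K = G - (X \<union> Y)" by (auto simp: gaps_def G_def X_def Y_def)
  have XY: "X \<inter> Y = {}"
  proof -
    have False if p: "(u, z) \<in> X" "(u, z) \<in> Y" for u z
    proof -
      have "u \<in> K" "z \<in> V" "z \<notin> K" "(u, f z) \<in> A" "(z, f u) \<in> A" using p by (auto simp: X_def Y_def G_def)
      then show False using optimal_no_exchange[OF f K] by blast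
    qed
    then show ?thesis by auto
  qed
  have XYG: "X \<union> Y \<subseteq> G" by (auto simp: X_def Y_def)
  have gap': "card (gaps f K) + (card X + card Y) = 2 * (m * (a - m))"
    unfolding gap using card_Un_disjoint[OF finXY XY] card_mono[OF finFG(2) XYG] cG
      card_Diff_subset[OF finite_subset[OF XYG finFG(2)] XYG] by simp
  have arcX: "card (A \<inter> K \<times> (V - K)) = card X"
  proof -
    have "inj_on (\<lambda>(u, z). (u, f z)) X"
      by (rule inj_onI) (use factor_inj[OF fac] in \<open>auto simp: X_def G_def\<close>)
    moreover have "(\<lambda>(u, z). (u, f z)) ` X = A \<inter> K \<times> (V - K)"
    proof
      show "(\<lambda>(u, z). (u, f z)) ` X \<subseteq> A \<inter> K \<times> (V - K)"
        using fL by (auto simp: X_def G_def)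
      show "A \<inter> K \<times> (V - K) \<subseteq> (\<lambda>(u, z). (u, f z)) ` X"
      proof clarify
        fix u w assume uw: "(u, w) \<in> A" "u \<in> K" "w \<in> V" "w \<notin> K"
        obtain z where z: "z \<in> V" "f z = w" using factor_onto[OF fac uw(3)] .
        then have "z \<notin> K" using uw(4) fK by blast
        then have "(u, z) \<in> X"
          using z uw arc_sides[OF uw(1)] factor_sides[OF fac, of z] disj unfolding X_def G_def by blast
        then show "(u, w) \<in> (\<lambda>(u, z). (u, f z)) ` X" using z by force
      qed
    qed
    ultimately show ?thesis using card_image by fastforce
  qed
  have arcY: "card (A\<inverse> \<inter> K \<times> (V - K)) = card Y"
  proof -
    have "inj_on (\<lambda>(u, z). (f u, z)) Y"
      by (rule inj_onI) (use factor_inj[OF fac] in \<open>auto simp: Y_def G_def\<close>)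
    moreover have "(\<lambda>(u, z). (f u, z)) ` Y = A\<inverse> \<inter> K \<times> (V - K)"
    proof
      show "(\<lambda>(u, z). (f u, z)) ` Y \<subseteq> A\<inverse> \<inter> K \<times> (V - K)"
        using fK by (auto simp: Y_def G_def)
      show "A\<inverse> \<inter> K \<times> (V - K) \<subseteq> (\<lambda>(u, z). (f u, z)) ` Y"
      proof clarify
        fix w z assume uw: "(z, w) \<in> A" "w \<in> K" "z \<in> V" "z \<notin> K"
        have "w \<in> V" using uw KV by blast
        then obtain u where u: "u \<in> V" "f u = w" using factor_onto[OF fac] by blast
        then have "u \<in> K" using invariant_back[OF fac KV fK] uw by blast
        then have "(u, z) \<in> Y"
          using u uw arc_sides[OF uw(1)] factor_sides[OF fac, of u] disj unfolding Y_def G_def by blast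
        then show "(w, z) \<in> (\<lambda>(u, z). (f u, z)) ` Y" using u by force
      qed
    qed
    ultimately show ?thesis using card_image by fastforce
  qed
  have split: "card (B \<inter> K \<times> UNIV) = card (B \<inter> K \<times> K) + card (B \<inter> K \<times> (V - K))"
    if "B \<subseteq> V \<times> V" "finite B" for B
  proof -
    have "B \<inter> K \<times> UNIV = (B \<inter> K \<times> K) \<union> (B \<inter> K \<times> (V - K))" using that by auto
    moreover have "card ((B \<inter> K \<times> K) \<union> (B \<inter> K \<times> (V - K))) = card (B \<inter> K \<times> K) + card (B \<inter> K \<times> (V - K))"
      by (rule card_Un_disjoint) (use that in auto)
    ultimately show ?thesis by simp
  qed
  have AV: "A \<subseteq> V \<times> V" using bip by blast
  have "A\<inverse> \<inter> K \<times> K = I\<inverse>" by (auto simp: I_def)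
  then have cI: "card (A\<inverse> \<inter> K \<times> K) = card I" by simp
  have "(\<Sum>v\<in>K. deg A v) = 2 * card I + card X + card Y"
    unfolding degree_sum_arcs[OF KV]
    using split[OF AV finA] split[of "A\<inverse>"] AV finA arcX arcY cI by (auto simp: I_def)
  moreover have "4 * (m * m) + 2 * (m * (a - m)) = 2 * m * (a + m)"
    using ma by (auto simp: algebra_simps diff_mult_distrib2)
  ultimately show ?thesis using miss gap' by linarith
qed

section \<open>Orbits as lists\<close>

definition ham_list :: "'a list \<Rightarrow> bool" where
  "ham_list xs \<longleftrightarrow> distinct xs \<and> set xs = V \<and> successively (\<lambda>u v. (u, v) \<in> A) xs \<and> (last xs, hd xs) \<in> A"

text \<open>A longest list that follows \<open>f\<close> from \<open>v\<close> without repetition must return to its first element,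
because \<open>f\<close> is injective.\<close>

lemma orbit_list:
  assumes f: "factor f" and v: "v \<in> V"
  obtains xs where "distinct xs" "xs \<noteq> []" "hd xs = v" "successively (\<lambda>p q. q = f p) xs"
    "f (last xs) = v" "invariant f (set xs)"
proof -
  define P where "P = (\<lambda>xs. distinct xs \<and> xs \<noteq> [] \<and> hd xs = v \<and> set xs \<subseteq> V \<and> successively (\<lambda>p q. q = f p) xs)"
  have "P [v]" using v by (simp add: P_def)
  moreover have "length xs < Suc (card V)" if "P xs" for xs
    using that card_mono[OF finV, of "set xs"] distinct_card[of xs] by (simp add: P_def)
  ultimately obtain xs where xs: "P xs" and max: "\<And>ys. P ys \<Longrightarrow> length ys \<le> length xs"
    using ex_has_greatest_nat[of P "[v]" length "Suc (card V)"] by blast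
  have xs': "distinct xs" "xs \<noteq> []" "hd xs = v" "set xs \<subseteq> V" "successively (\<lambda>p q. q = f p) xs"
    using xs by (simp_all add: P_def)
  have lastV: "last xs \<in> V" using xs'(2,4) last_in_set by blast
  have "f (last xs) \<in> set xs"
  proof (rule ccontr)
    assume "f (last xs) \<notin> set xs"
    then have "P (xs @ [f (last xs)])"
      using xs' factor_V[OF f lastV] by (simp add: P_def successively_append_iff)
    then show False using max by fastforce
  qed
  moreover define y where "y = f (last xs)"
  ultimately obtain as bs where ab: "xs = as @ y # bs" using split_list by fastforce
  have "as = []"
  proof (rule ccontr)
    assume as: "as \<noteq> []"
    have "y = f (last as)" using xs'(5) as unfolding ab by (simp add: successively_append_iff)
    then have "f (last xs) = f (last as)" using y_def by simp
    moreover have las: "last as \<in> set as" using as by simp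
    then have "last as \<in> V" using xs'(4) unfolding ab by auto
    ultimately have "last xs = last as" by (intro factor_inj[OF f lastV])
    moreover have "last xs \<in> set (y # bs)" unfolding ab by simp
    moreover have "set as \<inter> set (y # bs) = {}" using xs'(1) unfolding ab by simp
    ultimately show False using las by (metis disjoint_iff)
  qed
  then have "hd xs = y" unfolding ab by simp
  then have fl: "f (last xs) = v" using xs'(3) y_def by simp
  have "f w \<in> set xs" if w: "w \<in> set xs" for w
  proof -
    obtain as bs where ab: "xs = as @ w # bs" using split_list[OF w] by blast
    show ?thesis
    proof (cases bs)
      case Nil
      then have "last xs = w" using ab by simp
      then show ?thesis using fl xs'(2,3) hd_in_set[of xs] by simp
    next
      case (Cons b cs)
      then have "b = f w" using xs'(5) ab by (simp add: successively_append_iff)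
      then show ?thesis using ab Cons by simp
    qed
  qed
  then have "invariant f (set xs)" using xs'(4) unfolding invariant_def by blast
  then show ?thesis using that xs' fl by blast
qed

lemma ham_or_proper_invariant:
  assumes f: "factor f"
  shows "(\<exists>xs. ham_list xs) \<or> (\<exists>K. invariant f K \<and> K \<noteq> {} \<and> K \<noteq> V)"
proof -
  obtain v where v: "v \<in> V" using nonempty by blast
  obtain xs where xs: "distinct xs" "xs \<noteq> []" "hd xs = v" "successively (\<lambda>p q. q = f p) xs"
    "f (last xs) = v" "invariant f (set xs)" using orbit_list[OF f v] by blast
  show ?thesis
  proof (cases "set xs = V")
    case True
    have "successively (\<lambda>u v. (u, v) \<in> A) xs"
      by (rule successively_mono[OF xs(4)]) (use factor_arc[OF f] True in blast)
    moreover have "(last xs, hd xs) \<in> A" using factor_arc[OF f, of "last xs"] xs(2,3,5) last_in_set[of xs] True by simp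
    ultimately show ?thesis using xs(1) True unfolding ham_list_def by blast
  next
    case False
    then show ?thesis using xs(2,6) by (metis set_empty)
  qed
qed

section \<open>Orbits of length two\<close>

lemma card_le_if_sub_diff:
  assumes "finite X" "card X = a" "p \<in> X" "Z \<subseteq> X - {p}"
  shows "card Z \<le> a - 1"
  using card_mono[OF _ assms(4)] assms(1-3) by simp

text \<open>For a vertex of degree at least \<open>2a - 2\<close>, one absent arc in each direction certifies that all other
possible arcs at this vertex are present.\<close>

lemma two_missing:
  assumes v: "v \<in> V1" and p: "p \<in> V2" "(v, p) \<notin> A" and q: "q \<in> V2" "(q, v) \<notin> A"
  shows "deg A v \<le> 2 * a - 2"
    and "2 * a - 2 \<le> deg A v \<Longrightarrow> A `` {v} = V2 - {p} \<and> A\<inverse> `` {v} = V2 - {q}"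
proof -
  have o: "A `` {v} \<subseteq> V2 - {p}" using out_sub[OF v] p by blast
  have i: "A\<inverse> `` {v} \<subseteq> V2 - {q}" using in_sub[OF v] q by blast
  have co: "card (A `` {v}) \<le> a - 1" by (rule card_le_if_sub_diff[OF fin2 card2 p(1) o])
  have ci: "card (A\<inverse> `` {v}) \<le> a - 1" by (rule card_le_if_sub_diff[OF fin2 card2 q(1) i])
  show "deg A v \<le> 2 * a - 2" unfolding deg_def using co ci by linarith
  assume "2 * a - 2 \<le> deg A v"
  then have "card (A `` {v}) = a - 1" "card (A\<inverse> `` {v}) = a - 1" unfolding deg_def using co ci by linarith+
  moreover have "card (V2 - {p}) = a - 1" "card (V2 - {q}) = a - 1" using p q card2 fin2 by simp_all
  ultimately show "A `` {v} = V2 - {p} \<and> A\<inverse> `` {v} = V2 - {q}"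
    using o i fin2 by (simp add: card_subset_eq)
qed

text \<open>If \<open>d(x) \<le> a\<close>, then a vertex \<open>y'\<close> on the other side that is not adjacent to \<open>x\<close> would have degree at
most \<open>2a - 2\<close>, which is too small. So \<open>x\<close> is adjacent to all \<open>a\<close> vertices on the other side, and to
\<open>y\<close> twice.\<close>

lemma digon_degree1:
  assumes x: "x \<in> V1" and xy: "(x, y) \<in> A" "(y, x) \<in> A"
  shows "a + 1 \<le> deg A x"
proof (rule ccontr)
  interpret sw: meyniel_bipartite V2 V1 A a by (rule swap)
  assume n: "\<not> a + 1 \<le> deg A x"
  have fo: "finite (A `` {x})" "finite (A\<inverse> `` {x})"
    using out_sub[OF x] in_sub[OF x] fin2 finite_subset by blast+
  have "V2 \<subseteq> A `` {x} \<union> A\<inverse> `` {x}"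
  proof
    fix y' assume y': "y' \<in> V2"
    show "y' \<in> A `` {x} \<union> A\<inverse> `` {x}"
    proof (rule ccontr)
      assume c: "y' \<notin> A `` {x} \<union> A\<inverse> `` {x}"
      then have c': "(x, y') \<notin> A" "(y', x) \<notin> A" by blast+
      have "deg A y' \<le> 2 * a - 2" by (rule sw.two_missing(1)[OF y' x c'(2) x c'(1)])
      moreover have "3 * a \<le> deg A x + deg A y' + 1" by (rule meyniel) (use x y' c' disj in blast)+
      ultimately show False using n a3 by linarith
    qed
  qed
  then have "a \<le> card (A `` {x} \<union> A\<inverse> `` {x})"
    using card_mono[OF finite_UnI[OF fo]] card2 by blast
  moreover have "{y} \<subseteq> A `` {x} \<inter> A\<inverse> `` {x}" using xy by blast
  then have "card {y} \<le> card (A `` {x} \<inter> A\<inverse> `` {x})" using fo by (intro card_mono finite_Int) auto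
  ultimately show False using n card_Un_Int[OF fo] unfolding deg_def by simp
qed

lemma digon_degree2:
  assumes "x \<in> V2" "(x, y) \<in> A" "(y, x) \<in> A"
  shows "a + 1 \<le> deg A x"
  using meyniel_bipartite.digon_degree1[OF swap] assms by blast

lemma finite_gaps: "finite (gaps f K)"
proof -
  have "gaps f K \<subseteq> V \<times> V" by (auto simp: gaps_def)
  then show ?thesis using finite_subset finite_cartesian_product[OF finV finV] by blast
qed

text \<open>The degree count for \<open>{x, f x}\<close> bounds the sum of the two degrees by \<open>2a + 2\<close>, and each is at least
\<open>a + 1\<close> because the two vertices form a 2-cycle.\<close>

lemma two_cycle:
  assumes f: "optimal f" and x: "x \<in> V1" and ff: "f (f x) = x"
  shows "invariant f {x, f x}" "deg A x = a + 1" "deg A (f x) = a + 1" "gaps f {x, f x} = {}"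
proof -
  note fac = optimal_factor[OF f]
  have y: "f x \<in> V2" by (rule factor_sides(1)[OF fac x])
  show cl: "invariant f {x, f x}" unfolding invariant_def using x y ff by blast
  have xy: "(x, f x) \<in> A" using factor_arc[OF fac, of x] x by blast
  have yx: "(f x, x) \<in> A" using factor_arc[OF fac, of "f x"] y ff by auto
  have nx: "f x \<notin> V1" using y disj by blast
  have ne: "x \<noteq> f x" using nx x by metis
  from nx have "{x, f x} \<inter> V1 = {x}" using x by simp
  then have "card ({x, f x} \<inter> V1) = 1" by simp
  from degree_count[OF f cl this]
  have "deg A x + deg A (f x) + card (gaps f {x, f x}) \<le> 2 * (a + 1)" using ne by simp
  moreover have "a + 1 \<le> deg A x" by (rule digon_degree1[OF x xy yx])
  moreover have "a + 1 \<le> deg A (f x)" by (rule digon_degree2[OF y yx xy])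
  ultimately have "deg A x = a + 1" "deg A (f x) = a + 1" "card (gaps f {x, f x}) = 0" by arith+
  then show "deg A x = a + 1" "deg A (f x) = a + 1" "gaps f {x, f x} = {}"
    using finite_gaps[of f "{x, f x}"] by simp_all
qed

lemma two_cycle_others:
  assumes f: "optimal f" and x: "x \<in> V1" and ff: "f (f x) = x" and v: "v \<in> V - {x, f x}"
  shows "2 * a - 2 \<le> deg A v"
proof -
  note d = two_cycle[OF f x ff]
  have y: "f x \<in> V2" by (rule factor_sides(1)[OF optimal_factor[OF f] x])
  show ?thesis
  proof (cases "v \<in> V1")
    case True
    then have "3 * a \<le> deg A v + deg A x + 1" using meyniel1[OF True x] v by blast
    then show ?thesis using d(2) by linarith
  next
    case False
    then have "3 * a \<le> deg A v + deg A (f x) + 1" using meyniel2[OF _ y, of v] v by blast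
    then show ?thesis using d(3) by linarith
  qed
qed

text \<open>The vertex \<open>x1\<close> has degree \<open>a + 1 = 4\<close>, and its three out-neighbours and the arc from \<open>f x1\<close> use this
up. Optimality forbids arcs from \<open>x2\<close> and \<open>x3\<close> to \<open>f x1\<close>. So no arc enters \<open>{x1, f x1}\<close>.\<close>

lemma no_dominating_digon:
  assumes f: "optimal f" and V1: "V1 = {x1, x2, x3}" and a: "a = 3"
    and ff: "\<And>x. x \<in> V1 \<Longrightarrow> f (f x) = x"
    and ne: "x1 \<noteq> x2" "x1 \<noteq> x3" "x2 \<noteq> x3"
    and arc: "(x1, f x2) \<in> A" "(x1, f x3) \<in> A"
  shows False
proof -
  note fac = optimal_factor[OF f]
  have x: "x1 \<in> V1" "x2 \<in> V1" "x3 \<in> V1" using V1 by simp_all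
  note y = factor_sides(1)[OF fac x(1)] factor_sides(1)[OF fac x(2)] factor_sides(1)[OF fac x(3)]
  note cl = two_cycle(1)[OF f x(1) ff[OF x(1)]]
  have ney: "f x1 \<noteq> f x2" "f x1 \<noteq> f x3" "f x2 \<noteq> f x3" using ff x ne by metis+
  have "card {f x1, f x2, f x3} = 3" using ney by simp
  then have V2: "V2 = {f x1, f x2, f x3}" using y card2 a fin2 card_subset_eq[of V2 "{f x1, f x2, f x3}"] by simp
  have "(x1, f x1) \<in> A" using factor_arc[OF fac, of x1] x(1) by blast
  then have "A `` {x1} = {f x1, f x2, f x3}" using out_sub[OF x(1)] arc V2 by blast
  then have "card (A `` {x1}) = 3" using ney by simp
  then have i1: "card (A\<inverse> `` {x1}) = 1" using two_cycle(2)[OF f x(1) ff[OF x(1)]] a by (simp add: deg_def)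
  have "(f x1, x1) \<in> A" using factor_arc[OF fac, of "f x1"] y(1) ff[OF x(1)] by auto
  then have i2: "A\<inverse> `` {x1} = {f x1}" using i1 by (metis Image_singleton_iff card_1_singletonE converse_iff singletonD)
  have xin: "x2 \<in> V - {x1, f x1}" "x3 \<in> V - {x1, f x1}" using x ne y disj by blast+
  have o2: "(x2, f x1) \<notin> A" by (rule optimal_no_exchange[OF f cl _ _ _ arc(1)]) (use xin in blast)+
  have o3: "(x3, f x1) \<notin> A" by (rule optimal_no_exchange[OF f cl _ _ _ arc(2)]) (use xin in blast)+
  have "\<exists>u\<in>V - {x1, f x1}. \<exists>v\<in>V - (V - {x1, f x1}). (u, v) \<in> A"
    by (rule cut) (use x y xin in blast)+
  then obtain u v where uv: "u \<in> V - {x1, f x1}" "v \<in> {x1, f x1}" "(u, v) \<in> A" by blast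
  show False
  proof (cases "v = x1")
    case True
    then show False using i2 uv by blast
  next
    case False
    then have v: "v = f x1" using uv by blast
    then have "u \<in> V1" using arc_sides[OF uv(3)] y(1) disj by blast
    then have "u = x2 \<or> u = x3" using V1 uv(1) by blast
    then show False using uv(3) o2 o3 unfolding v by metis
  qed
qed

text \<open>The arcs \<open>u \<rightarrow> f z\<close> define a tournament on the three vertices of \<open>V1\<close>. It has no vertex that dominates
the other two, so it is a directed triangle, and the triangle together with the three
2-cycles gives a hamiltonian cycle.\<close>

lemma no_three_digons:
  assumes f: "optimal f" and nh: "\<And>xs. \<not> ham_list xs" and V1: "V1 = {x1, x2, x3}" and a: "a = 3"
    and ff: "\<And>x. x \<in> V1 \<Longrightarrow> f (f x) = x"
    and ne: "x1 \<noteq> x2" "x1 \<noteq> x3" "x2 \<noteq> x3"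
  shows False
proof -
  note fac = optimal_factor[OF f]
  have x: "x1 \<in> V1" "x2 \<in> V1" "x3 \<in> V1" using V1 by simp_all
  note y = factor_sides(1)[OF fac x(1)] factor_sides(1)[OF fac x(2)] factor_sides(1)[OF fac x(3)]
  have ney: "f x1 \<noteq> f x2" "f x1 \<noteq> f x3" "f x2 \<noteq> f x3" using ff x ne by metis+
  have "card {f x1, f x2, f x3} = 3" using ney by simp
  then have V2: "V2 = {f x1, f x2, f x3}" using y card2 a fin2 card_subset_eq[of V2 "{f x1, f x2, f x3}"] by simp
  have nexy: "u \<noteq> f v" if "u \<in> V1" "v \<in> V1" for u v
    using factor_sides(1)[OF fac that(2)] that(1) disj by (metis disjoint_iff)
  have or: "(u, f z) \<in> A \<or> (z, f u) \<in> A" if "u \<in> V1" "z \<in> V1" "u \<noteq> z" for u z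
  proof (rule ccontr)
    assume "\<not> ?thesis"
    then have "(u, z) \<in> gaps f {u, f u}" using that nexy[of z u] by (auto simp: gaps_def)
    then show False using two_cycle(4)[OF f that(1) ff[OF that(1)]] by blast
  qed
  have V1': "V1 = {x2, x1, x3}" "V1 = {x3, x1, x2}" using V1 by blast+
  have dom1: "\<not> ((x1, f x2) \<in> A \<and> (x1, f x3) \<in> A)" using no_dominating_digon[OF f V1 a ff] ne by blast
  have dom2: "\<not> ((x2, f x1) \<in> A \<and> (x2, f x3) \<in> A)"
    using no_dominating_digon[OF f V1'(1) a ff] ne by metis
  have dom3: "\<not> ((x3, f x1) \<in> A \<and> (x3, f x2) \<in> A)"
    using no_dominating_digon[OF f V1'(2) a ff] ne by metis
  have rev: "(f u, u) \<in> A" if "u \<in> V1" for u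
    using factor_arc[OF fac, of "f u"] factor_sides(1)[OF fac that] ff[OF that] by auto
  show False
  proof (cases "(x1, f x2) \<in> A")
    case True
    then have "(x3, f x1) \<in> A" using or[of x1 x3] dom1 x ne by blast
    then have "(x2, f x3) \<in> A" using or[of x2 x3] dom3 x ne by blast
    then have "ham_list [x1, f x2, x2, f x3, x3, f x1]"
      unfolding ham_list_def using True \<open>(x3, f x1) \<in> A\<close> rev x ne ney nexy V1 V2 by auto
    then show False using nh by blast
  next
    case False
    then have "(x2, f x1) \<in> A" using or[of x1 x2] x ne by blast
    then have "(x3, f x2) \<in> A" using or[of x2 x3] dom2 x ne by blast
    then have "(x1, f x3) \<in> A" using or[of x1 x3] dom3 x ne by blast
    then have "ham_list [x1, f x3, x3, f x2, x2, f x1]"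
      unfolding ham_list_def using \<open>(x2, f x1) \<in> A\<close> \<open>(x3, f x2) \<in> A\<close> rev x ne ney nexy V1 V2 by auto
    then show False using nh by blast
  qed
qed

lemma invariant_sum_lower:
  assumes f: "optimal f" and K: "invariant f K" and m: "card (K \<inter> V1) = m"
    and d: "\<And>v. v \<in> K \<Longrightarrow> d \<le> deg A v"
  shows "2 * m * d \<le> 2 * m * (a + m)"
proof -
  have KV: "K \<subseteq> V" using K by (simp add: invariant_def)
  have "card K = card (K \<inter> V1) + card (K \<inter> V2)"
  proof -
    have "K = (K \<inter> V1) \<union> (K \<inter> V2)" using KV by blast
    moreover have "card ((K \<inter> V1) \<union> (K \<inter> V2)) = card (K \<inter> V1) + card (K \<inter> V2)"
      by (rule card_Un_disjoint) (use fin1 fin2 disj in auto)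
    ultimately show ?thesis by simp
  qed
  then have "card K = 2 * m" using invariant_half[OF optimal_factor[OF f] K] m by simp
  moreover have "of_nat (card K) * d \<le> (\<Sum>v\<in>K. deg A v)" by (rule sum_bounded_below[OF d])
  ultimately have "2 * m * d \<le> (\<Sum>v\<in>K. deg A v)" by simp
  also have "\<dots> \<le> 2 * m * (a + m)" using degree_count[OF f K m] by (metis add.assoc le_add1)
  finally show ?thesis .
qed

lemma invariant_half_pos:
  assumes f: "factor f" and K: "invariant f K" "K \<noteq> {}"
  shows "0 < card (K \<inter> V1)"
proof -
  obtain v where v: "v \<in> K" "v \<in> V" "f v \<in> K" using K unfolding invariant_def by blast
  have "v \<in> K \<inter> V1 \<or> f v \<in> K \<inter> V1" using v factor_sides[OF f] by blast
  then have "K \<inter> V1 \<noteq> {}" by blast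
  then show ?thesis using fin1 by (simp add: card_gt_0_iff)
qed

lemma invariant_diff:
  assumes f: "factor f" and "invariant f K" "invariant f L"
  shows "invariant f (K - L)"
  using invariant_compl[OF f assms(3)] assms(2) unfolding invariant_def by blast

text \<open>All vertices outside the 2-cycle have degree at least \<open>2a - 2\<close>, so by the degree count an invariant
set among them has at least \<open>a - 2\<close> vertices on each side. Two disjoint ones fit into the \<open>a - 1\<close>
available vertices only if \<open>a = 3\<close> and all orbits have length two, which \<open>no_three_digons\<close> excludes.\<close>

lemma two_cycle_rest:
  assumes f: "optimal f" and nh: "\<And>xs. \<not> ham_list xs" and x: "x \<in> V1" and ff: "f (f x) = x"
    and K: "invariant f K" "K \<subseteq> V - {x, f x}" "K \<noteq> {}"
  shows "K = V - {x, f x}"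
proof (rule ccontr)
  assume n: "K \<noteq> V - {x, f x}"
  note fac = optimal_factor[OF f]
  note cl = two_cycle(1)[OF f x ff]
  have y: "f x \<in> V2" by (rule factor_sides(1)[OF fac x])
  define L where "L = (V - {x, f x}) - K"
  have L: "invariant f L" unfolding L_def by (rule invariant_diff[OF fac invariant_compl[OF fac cl] K(1)])
  have Lne: "L \<noteq> {}" using n K(2) unfolding L_def by blast
  define m l where "m = card (K \<inter> V1)" and "l = card (L \<inter> V1)"
  have "V1 = {x} \<union> ((K \<inter> V1) \<union> (L \<inter> V1))" using K(2) x y disj by (auto simp: L_def)
  moreover have "card ({x} \<union> ((K \<inter> V1) \<union> (L \<inter> V1))) = 1 + (m + l)"
  proof -
    have "card ((K \<inter> V1) \<union> (L \<inter> V1)) = m + l" unfolding m_def l_def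
      by (rule card_Un_disjoint) (use fin1 in \<open>auto simp: L_def\<close>)
    moreover have "x \<notin> (K \<inter> V1) \<union> (L \<inter> V1)" using K(2) by (auto simp: L_def)
    ultimately show ?thesis using fin1 by simp
  qed
  ultimately have ml: "a = 1 + (m + l)" using card1 by simp
  have m0: "0 < m" and l0: "0 < l" unfolding m_def l_def
    using invariant_half_pos[OF fac] K L Lne by blast+
  have "2 * m * (2 * a - 2) \<le> 2 * m * (a + m)"
    by (rule invariant_sum_lower[OF f K(1)]) (use m_def two_cycle_others[OF f x ff] K(2) in auto)
  then have 1: "2 * a - 2 \<le> a + m" using m0 by simp
  have "2 * l * (2 * a - 2) \<le> 2 * l * (a + l)"
    by (rule invariant_sum_lower[OF f L]) (use l_def two_cycle_others[OF f x ff] L_def in auto)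
  then have 2: "2 * a - 2 \<le> a + l" using l0 by simp
  have a: "a = 3" and m1: "m = 1" and l1: "l = 1" using 1 2 ml m0 l0 a3 by linarith+
  obtain x2 where x2: "K \<inter> V1 = {x2}" using m1 m_def card_1_singletonE by metis
  obtain x3 where x3: "L \<inter> V1 = {x3}" using l1 l_def card_1_singletonE by metis
  have V1: "V1 = {x, x2, x3}" using \<open>V1 = {x} \<union> ((K \<inter> V1) \<union> (L \<inter> V1))\<close> x2 x3 by blast
  have ne: "x \<noteq> x2" "x \<noteq> x3" "x2 \<noteq> x3" using x2 x3 K(2) unfolding L_def by blast+
  have ffK: "f (f v) \<in> M \<inter> V1" if "v \<in> M \<inter> V1" "invariant f M" for v M
    using that factor_sides[OF fac] unfolding invariant_def by blast
  have f2: "f (f x2) = x2" using ffK[of x2 K] x2 K(1) by blast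
  have f3: "f (f x3) = x3" using ffK[of x3 L] x3 L by blast
  have "f (f v) = v" if "v \<in> V1" for v using that ff f2 f3 unfolding V1 by auto
  then show False using no_three_digons[OF f nh V1 a _ ne] by blast
qed

section \<open>A vertex isolated from an orbit\<close>

text \<open>Let \<open>I\<close> be the set of vertices outside \<open>C\<close> that receive an arc from \<open>C\<close>. If every vertex outside \<open>C\<close> had
an arc from or to \<open>C\<close>, then by the alternative the vertices outside \<open>C\<close> and \<open>I\<close> would be mapped
among themselves, so \<open>I\<close> would be empty or everything. Both contradict strong connectivity.\<close>

lemma isolated_from_invariant:
  assumes f: "factor f" and C: "invariant f C" "C \<noteq> {}" "C \<noteq> V"
    and single: "\<And>K. invariant f K \<Longrightarrow> K \<subseteq> V - C \<Longrightarrow> K \<noteq> {} \<Longrightarrow> K = V - C"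
    and alt: "\<And>z. z \<in> V - C \<Longrightarrow> (\<exists>c\<in>C. (z, c) \<in> A) \<noteq> (\<exists>c\<in>C. (c, f z) \<in> A)"
  shows "\<exists>w\<in>V - C. \<forall>c\<in>C. (w, c) \<notin> A \<and> (c, w) \<notin> A"
proof (rule ccontr)
  assume "\<not> ?thesis"
  then have n: "(\<exists>c\<in>C. (z, c) \<in> A) \<or> (\<exists>c\<in>C. (c, z) \<in> A)" if "z \<in> V - C" for z
    using that by blast
  have CV: "C \<subseteq> V" using C(1) by (simp add: invariant_def)
  define K where "K = {z \<in> V - C. \<not> (\<exists>c\<in>C. (c, z) \<in> A)}"
  have fD: "f z \<in> V - C" if "z \<in> V - C" for z using invariant_compl[OF f C(1)] that unfolding invariant_def by blast
  have "f z \<in> K" if "z \<in> K" for z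
  proof -
    have z: "z \<in> V - C" "\<not> (\<exists>c\<in>C. (c, z) \<in> A)" using that by (auto simp: K_def)
    then have "\<exists>c\<in>C. (z, c) \<in> A" using n by blast
    then have "\<not> (\<exists>c\<in>C. (c, f z) \<in> A)" using alt[OF z(1)] by blast
    then show ?thesis using fD[OF z(1)] by (simp add: K_def)
  qed
  moreover have "K \<subseteq> V - C" unfolding K_def by blast
  ultimately have K: "invariant f K" unfolding invariant_def by blast
  have "\<exists>u\<in>C. \<exists>v\<in>V - C. (u, v) \<in> A" by (rule cut[OF CV C(2,3)])
  then have "K \<noteq> V - C" unfolding K_def by blast
  then have "K = {}" using single[OF K \<open>K \<subseteq> V - C\<close>] by blast
  have "\<exists>u\<in>V - C. \<exists>v\<in>V - (V - C). (u, v) \<in> A" by (rule cut) (use CV C in blast)+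
  then obtain z c where z: "z \<in> V - C" "c \<in> C" "(z, c) \<in> A" by blast
  then have "\<not> (\<exists>c\<in>C. (c, f z) \<in> A)" using alt[OF z(1)] by blast
  then have "f z \<in> K" using fD[OF z(1)] by (simp add: K_def)
  then show False using \<open>K = {}\<close> by blast
qed

section \<open>Factors without orbits of length two\<close>

text \<open>Since \<open>C\<close> induces a complete bipartite digraph, \<open>f\<close> can be conjugated by the transposition \<open>t\<close> of \<open>y\<close> and
\<open>f x\<close>. This is again a factor with an orbit relation of the same size, but it maps \<open>x\<close> to \<open>y\<close>, so the two given
arcs would allow an exchange.\<close>

lemma complete_no_detour:
  assumes f: "optimal f" and C: "invariant f C" and full: "missing C = {}"
    and x: "x \<in> C" and y: "y \<in> C" and z: "z \<in> V - C"
    and arcs: "(x, f z) \<in> A" "(z, y) \<in> A"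
  shows False
proof -
  note fac = optimal_factor[OF f]
  have CV: "C \<subseteq> V" and fC: "f ` C \<subseteq> C" using C by (auto simp: invariant_def)
  have zV: "z \<in> V" and zC: "z \<notin> C" and xV: "x \<in> V" using z x CV by blast+
  have fxC: "f x \<in> C" using x fC by blast
  define t where "t = (\<lambda>v. if v = y then f x else if v = f x then y else v)"
  define g where "g = (\<lambda>v. t (f (t v)))"
  have tt: "t (t v) = v" for v by (auto simp: t_def)
  have tC: "t v \<in> C" if "v \<in> C" for v using that y fxC by (simp add: t_def)
  have tnC: "t v = v" if "v \<notin> C" for v using that y fxC by (auto simp: t_def)
  have sides: "x \<in> V1 \<and> f x \<in> V2 \<and> y \<in> V2 \<or> x \<in> V2 \<and> f x \<in> V1 \<and> y \<in> V1"
    using arc_sides[OF arcs(1)] arc_sides[OF arcs(2)] factor_sides[OF fac, of z] factor_sides[OF fac, of x] disj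
    by blast
  have t1: "t v \<in> V1" if "v \<in> V1" for v
  proof -
    have "v = y \<or> v = f x \<Longrightarrow> y \<in> V1 \<and> f x \<in> V1" using sides that disj by (metis disjoint_iff)
    then show ?thesis using that by (simp add: t_def)
  qed
  have t2: "t v \<in> V2" if "v \<in> V2" for v
  proof -
    have "v = y \<or> v = f x \<Longrightarrow> y \<in> V2 \<and> f x \<in> V2" using sides that disj by (metis disjoint_iff)
    then show ?thesis using that by (simp add: t_def)
  qed
  have tV: "t v \<in> V" if "v \<in> V" for v using that t1 t2 by blast
  have gC: "g v \<in> C" if "v \<in> C" for v using tC[OF that] fC tC unfolding g_def by blast
  have gnC: "g v = f v" if "v \<in> V - C" for v
  proof -
    have "f v \<notin> C" using invariant_compl[OF fac C] that unfolding invariant_def by blast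
    then show ?thesis using that tnC unfolding g_def by simp
  qed
  have facg: "factor g"
  proof (rule factorI)
    show "inj_on g V"
    proof (rule inj_onI)
      fix v w assume vw: "v \<in> V" "w \<in> V" "g v = g w"
      then have "f (t v) = f (t w)" unfolding g_def by (metis tt)
      then have "t v = t w" by (rule factor_inj[OF fac tV[OF vw(1)] tV[OF vw(2)]])
      then show "v = w" by (metis tt)
    qed
    fix v assume v: "v \<in> V"
    show "(v, g v) \<in> A"
    proof (cases "v \<in> C")
      case True
      have "v \<in> V1 \<and> g v \<in> V2 \<or> v \<in> V2 \<and> g v \<in> V1"
        using v t1 t2 factor_sides[OF fac] unfolding g_def by blast
      then have "(v, g v) \<notin> A \<Longrightarrow> (v, g v) \<in> missing C" using True gC[OF True] unfolding missing_def by blast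
      then show ?thesis using full by blast
    next
      case False
      then show ?thesis using gnC factor_arc[OF fac v] v by simp
    qed
  qed
  let ?F = "{(v, f v) |v. v \<in> V}" and ?G = "{(v, g v) |v. v \<in> V}"
  have tFG: "(t p, t q) \<in> ?G" if "(p, q) \<in> ?F" for p q
  proof -
    have p: "p \<in> V" "q = f p" using that by blast+
    have "g (t p) = t q" unfolding g_def p(2) tt ..
    then show ?thesis using tV[OF p(1)] by force
  qed
  have step: "(t p, t q) \<in> ?G\<^sup>*" if "(p, q) \<in> ?F\<^sup>*" for p q
    using that
  proof induction
    case (step q r)
    then show ?case using rtrancl_into_rtrancl[OF step.IH tFG[OF step.hyps(2)]] by simp
  qed simp
  have "inj t" by (rule inj_on_inverseI[where g = t]) (rule tt)
  then have "inj_on (\<lambda>(p, q). (t p, t q)) (reach f)" by (auto simp: inj_on_def)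
  then have eq: "card (reach f) = card ((\<lambda>(p, q). (t p, t q)) ` reach f)" by (rule card_image[symmetric])
  have "(\<lambda>(p, q). (t p, t q)) ` reach f \<subseteq> reach g"
  proof clarify
    fix p q assume "(p, q) \<in> reach f"
    then have "(p, q) \<in> ?F\<^sup>*" "p \<in> V" "q \<in> V" unfolding reach_def by blast+
    then show "(t p, t q) \<in> reach g" using step[of p q] tV unfolding reach_def by blast
  qed
  then have "card ((\<lambda>(p, q). (t p, t q)) ` reach f) \<le> card (reach g)" by (rule card_mono[OF finite_reach])
  then have le: "card (reach f) \<le> card (reach g)" using eq by simp
  have "x \<noteq> f x" "x \<noteq> y" using sides disj by (metis disjoint_iff)+
  then have "t x = x" "t (f x) = y" by (simp_all add: t_def)
  then have gx: "g x = y" unfolding g_def by simp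
  have "invariant g C" using CV gC unfolding invariant_def by blast
  then have "\<exists>h. factor h \<and> card (reach g) < card (reach h)"
    by (rule exchange_enlarges_reach[OF facg _ x zV zC]) (use arcs gx gnC[OF z] in simp_all)
  then show False using f le unfolding optimal_def by (metis le_trans not_less)
qed

text \<open>Since there are fewer than \<open>m\<close> gaps, every vertex \<open>z\<close> outside has an arc to \<open>C\<close> or its successor
receives one, and by \<open>complete_no_detour\<close> not both. So there is a vertex \<open>w\<close> with no arc to or from
\<open>C\<close>. It has degree at most \<open>2(a - m)\<close>, and every vertex of \<open>C\<close> would need a degree of at least
\<open>a - 1 + 2m\<close>, which is too much for the degree count.\<close>

lemma complete_part_contradiction:
  assumes f: "optimal f" and C: "invariant f C" "C \<noteq> V" and full: "missing C = {}"
    and m: "card (C \<inter> V1) = m" "2 \<le> m" and gaps: "card (gaps f C) < m"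
    and single: "\<And>K. invariant f K \<Longrightarrow> K \<subseteq> V - C \<Longrightarrow> K \<noteq> {} \<Longrightarrow> K = V - C"
  shows False
proof -
  note fac = optimal_factor[OF f]
  have CV: "C \<subseteq> V" using C by (simp add: invariant_def)
  have Cne: "C \<noteq> {}" using m by auto
  have m2: "card (C \<inter> V2) = m" using invariant_half[OF fac C(1)] m by simp
  have alt: "(\<exists>c\<in>C. (z, c) \<in> A) \<noteq> (\<exists>c\<in>C. (c, f z) \<in> A)" if z: "z \<in> V - C" for z
  proof -
    have "\<not> ((\<exists>c\<in>C. (z, c) \<in> A) \<and> (\<exists>c\<in>C. (c, f z) \<in> A))"
      using complete_no_detour[OF f C(1) full _ _ z] by blast
    moreover have "(\<exists>c\<in>C. (z, c) \<in> A) \<or> (\<exists>c\<in>C. (c, f z) \<in> A)"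
    proof (rule ccontr)
      assume n: "\<not> ?thesis"
      have fc: "f c \<in> C" if "c \<in> C" for c using that C unfolding invariant_def by blast
      define S where "S = (if z \<in> V1 then C \<inter> V1 else C \<inter> V2)"
      have "(\<lambda>u. (u, z)) ` S \<subseteq> gaps f C"
        using z n fc unfolding S_def gaps_def by auto
      then have "card ((\<lambda>u. (u, z)) ` S) \<le> card (gaps f C)" by (rule card_mono[OF finite_gaps])
      moreover have "card ((\<lambda>u. (u, z)) ` S) = card S" by (rule card_image) (simp add: inj_on_def)
      moreover have "card S = m" using m m2 by (simp add: S_def)
      ultimately show False using gaps by simp
    qed
    ultimately show ?thesis by blast
  qed
  obtain w where w: "w \<in> V - C" "\<And>c. c \<in> C \<Longrightarrow> (w, c) \<notin> A" "\<And>c. c \<in> C \<Longrightarrow> (c, w) \<notin> A"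
    using isolated_from_invariant[OF fac C(1) Cne C(2) single alt] by blast
  have c1: "card (V1 - C) = a - m"
    using card_Diff_subset_Int[of V1 C] fin1 card1 m by (simp add: Int_commute)
  have c2: "card (V2 - C) = a - m"
    using card_Diff_subset_Int[of V2 C] fin2 card2 m2 by (simp add: Int_commute)
  have ma: "m \<le> a" using card_mono[OF fin1, of "C \<inter> V1"] m card1 by simp
  have "deg A w \<le> 2 * (a - m)"
  proof (cases "w \<in> V1")
    case True
    have "A `` {w} \<subseteq> V2 - C" "A\<inverse> `` {w} \<subseteq> V2 - C"
      using out_sub[OF True] in_sub[OF True] w by blast+
    then have "card (A `` {w}) \<le> a - m" "card (A\<inverse> `` {w}) \<le> a - m"
      using card_mono[OF finite_Diff[OF fin2]] c2 by metis+
    then show ?thesis by (simp add: deg_def)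
  next
    case False
    then have wV: "w \<in> V2" using w by blast
    have "A `` {w} \<subseteq> V1 - C" "A\<inverse> `` {w} \<subseteq> V1 - C"
      using bip wV disj w by blast+
    then have "card (A `` {w}) \<le> a - m" "card (A\<inverse> `` {w}) \<le> a - m"
      using card_mono[OF finite_Diff[OF fin1]] c1 by metis+
    then show ?thesis by (simp add: deg_def)
  qed
  then have "a - 1 + 2 * m \<le> deg A v" if "v \<in> C" for v
    using meyniel[of v w] w that CV ma by fastforce
  then have "2 * m * (a - 1 + 2 * m) \<le> 2 * m * (a + m)" by (rule invariant_sum_lower[OF f C(1) m(1)])
  then have "a - 1 + 2 * m \<le> a + m" using m(2) by simp
  then show False using m(2) a3 by linarith
qed

lemma side_sum_odd:
  assumes "X \<subseteq> V1 \<or> X \<subseteq> V2" "2 \<le> card X" "2 * c + 1 = 3 * a"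
  shows "card X * c \<le> (\<Sum>v\<in>X. deg A v)"
proof (rule sum_ge_of_pairs_even)
  show "finite X" using assms(1) fin1 fin2 finite_subset by blast
  show "2 * c \<le> deg A u + deg A v" if "u \<in> X" "v \<in> X" "u \<noteq> v" for u v
    using meyniel1[of u v] meyniel2[of u v] assms(1,3) that by fastforce
qed (rule assms(2))

lemma side_sum_even:
  assumes "X \<subseteq> V1 \<or> X \<subseteq> V2" "2 \<le> card X" "2 * c = 3 * a"
  shows "card X * c \<le> (\<Sum>v\<in>X. deg A v) + 1"
proof (rule sum_ge_of_pairs_odd)
  show "finite X" using assms(1) fin1 fin2 finite_subset by blast
  show "2 * c \<le> deg A u + deg A v + 1" if "u \<in> X" "v \<in> X" "u \<noteq> v" for u v
    using meyniel1[of u v] meyniel2[of u v] assms(1,3) that by fastforce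
qed (rule assms(2))

lemma sum_sides:
  assumes "K \<subseteq> V"
  shows "(\<Sum>v\<in>K. deg A v) = (\<Sum>v\<in>K \<inter> V1. deg A v) + (\<Sum>v\<in>K \<inter> V2. deg A v)"
proof -
  have "K = (K \<inter> V1) \<union> (K \<inter> V2)" using assms by blast
  moreover have "(\<Sum>v\<in>(K \<inter> V1) \<union> (K \<inter> V2). deg A v) = (\<Sum>v\<in>K \<inter> V1. deg A v) + (\<Sum>v\<in>K \<inter> V2. deg A v)"
    by (rule sum.union_disjoint) (use fin1 fin2 disj in auto)
  ultimately show ?thesis by simp
qed

lemma invariant_at_least_two:
  assumes f: "factor f" and no2: "\<And>v. v \<in> V \<Longrightarrow> f (f v) \<noteq> v" and K: "invariant f K" "K \<noteq> {}"
  shows "2 \<le> card (K \<inter> V1)"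
proof -
  have "K \<inter> V1 \<noteq> {}" using invariant_half_pos[OF f K] by auto
  then obtain v where v: "v \<in> K" "v \<in> V1" by blast
  have "f (f v) \<in> K" "f (f v) \<in> V1" using v K(1) factor_sides[OF f] unfolding invariant_def by blast+
  then have "{v, f (f v)} \<subseteq> K \<inter> V1" using v by blast
  then have "card {v, f (f v)} \<le> card (K \<inter> V1)" using fin1 by (intro card_mono) auto
  moreover have "f (f v) \<noteq> v" using no2 v by blast
  ultimately show ?thesis by auto
qed

lemma invariant_sum_odd:
  assumes f: "optimal f" and K: "invariant f K" and m: "card (K \<inter> V1) = m" "2 \<le> m" and c: "2 * c + 1 = 3 * a"
  shows "2 * (m * c) + 2 * card (missing K) + card (gaps f K) \<le> 2 * m * (a + m)"
proof -
  have m2: "card (K \<inter> V2) = m" using invariant_half[OF optimal_factor[OF f] K] m by simp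
  have "m * c \<le> (\<Sum>v\<in>K \<inter> V1. deg A v)" using side_sum_odd[of "K \<inter> V1" c] m c by simp
  moreover have "m * c \<le> (\<Sum>v\<in>K \<inter> V2. deg A v)" using side_sum_odd[of "K \<inter> V2" c] m m2 c by simp
  moreover have "K \<subseteq> V" using K by (simp add: invariant_def)
  ultimately show ?thesis using degree_count[OF f K m(1)] sum_sides[of K] by linarith
qed

lemma invariant_sum_even:
  assumes f: "optimal f" and K: "invariant f K" and m: "card (K \<inter> V1) = m" "2 \<le> m" and c: "2 * c = 3 * a"
  shows "2 * (m * c) \<le> 2 * m * (a + m) + 2"
proof -
  have m2: "card (K \<inter> V2) = m" using invariant_half[OF optimal_factor[OF f] K] m by simp
  have "m * c \<le> (\<Sum>v\<in>K \<inter> V1. deg A v) + 1" using side_sum_even[of "K \<inter> V1" c] m c by simp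
  moreover have "m * c \<le> (\<Sum>v\<in>K \<inter> V2. deg A v) + 1" using side_sum_even[of "K \<inter> V2" c] m m2 c by simp
  moreover have "K \<subseteq> V" using K by (simp add: invariant_def)
  ultimately show ?thesis using degree_count[OF f K m(1)] sum_sides[of K] by linarith
qed

text \<open>The bound \<open>m(3a - 1) \<le> 2m(a + m)\<close> gives the claim for odd \<open>a\<close>. For even \<open>a\<close> the pairwise bound \<open>3a - 1\<close>
is odd and acts like \<open>3a\<close> up to one unit on each side.\<close>

lemma invariant_large:
  assumes f: "optimal f" and no2: "\<And>v. v \<in> V \<Longrightarrow> f (f v) \<noteq> v" and K: "invariant f K" "K \<noteq> {}"
  shows "a \<le> 2 * card (K \<inter> V1) + 1"
proof -
  define m where "m = card (K \<inter> V1)"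
  have m2: "2 \<le> m" using invariant_at_least_two[OF optimal_factor[OF f] no2 K] m_def by simp
  show ?thesis
  proof (cases "even a")
    case True
    then obtain b where b: "a = 2 * b" by blast
    have "2 * (m * (3 * b)) \<le> 2 * m * (a + m) + 2"
      by (rule invariant_sum_even[OF f K(1) m_def[symmetric] m2]) (simp add: b)
    then have "m * (3 * b) \<le> m * (a + m) + 1" by simp
    moreover have "\<not> a + m + 1 \<le> 3 * b"
    proof
      assume "a + m + 1 \<le> 3 * b"
      then have "m * (a + m + 1) \<le> m * (3 * b)" by (rule mult_le_mono2)
      then show False using \<open>m * (3 * b) \<le> m * (a + m) + 1\<close> m2 by (simp add: algebra_simps)
    qed
    ultimately show ?thesis using b m_def by linarith
  next
    case False
    then obtain b where b: "a = 2 * b + 1" by (metis oddE)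
    have "2 * (m * (3 * b + 1)) + 2 * card (missing K) + card (gaps f K) \<le> 2 * m * (a + m)"
      by (rule invariant_sum_odd[OF f K(1) m_def[symmetric] m2]) (simp add: b)
    then have "(2 * m) * (3 * b + 1) \<le> (2 * m) * (a + m)" by (simp add: algebra_simps)
    then have "3 * b + 1 \<le> a + m" using m2 by (subst (asm) mult_le_cancel1) simp
    then show ?thesis using b m_def by linarith
  qed
qed

lemma invariant_card_compl:
  assumes "K \<subseteq> V"
  shows "card ((V - K) \<inter> V1) = a - card (K \<inter> V1)"
proof -
  have "(V - K) \<inter> V1 = V1 - K \<inter> V1" by blast
  then show ?thesis using card_Diff_subset[of "K \<inter> V1" V1] fin1 card1 by simp
qed

text \<open>Three disjoint invariant sets would need \<open>3(a - 1) \<le> 2a\<close>, that is, \<open>a \<le> 3\<close>, but each of them has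
two vertices on each side.\<close>

lemma two_parts_only:
  assumes f: "optimal f" and no2: "\<And>v. v \<in> V \<Longrightarrow> f (f v) \<noteq> v" and C: "invariant f C" "C \<noteq> {}"
    and K: "invariant f K" "K \<subseteq> V - C" "K \<noteq> {}"
  shows "K = V - C"
proof (rule ccontr)
  assume n: "K \<noteq> V - C"
  note fac = optimal_factor[OF f]
  define L where "L = (V - C) - K"
  have L: "invariant f L" unfolding L_def by (rule invariant_diff[OF fac invariant_compl[OF fac C(1)] K(1)])
  have Lne: "L \<noteq> {}" using n K(2) unfolding L_def by blast
  have "a = card (C \<inter> V1) + card (K \<inter> V1) + card (L \<inter> V1)"
  proof -
    have "V1 = (C \<inter> V1) \<union> ((K \<inter> V1) \<union> (L \<inter> V1))" using K(2) by (auto simp: L_def)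
    moreover have "card ((C \<inter> V1) \<union> ((K \<inter> V1) \<union> (L \<inter> V1))) = card (C \<inter> V1) + card ((K \<inter> V1) \<union> (L \<inter> V1))"
      by (rule card_Un_disjoint) (use fin1 K(2) in \<open>auto simp: L_def\<close>)
    moreover have "card ((K \<inter> V1) \<union> (L \<inter> V1)) = card (K \<inter> V1) + card (L \<inter> V1)"
      by (rule card_Un_disjoint) (use fin1 in \<open>auto simp: L_def\<close>)
    ultimately show ?thesis using card1 by simp
  qed
  moreover note invariant_large[OF f no2 C] invariant_large[OF f no2 K(1,3)] invariant_large[OF f no2 L Lne]
    invariant_at_least_two[OF fac no2 C] invariant_at_least_two[OF fac no2 K(1,3)] invariant_at_least_two[OF fac no2 L Lne]
  ultimately show False by linarith
qed

lemma gaps_compl: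
  assumes "K \<subseteq> V"
  shows "gaps f (V - K) = (gaps f K)\<inverse>"
  using assms unfolding gaps_def by auto

text \<open>Without orbits of length two there are two invariant parts whose sizes on one side differ by at most one.
For odd \<open>a\<close> the degree condition is tight on the smaller part, so that this part has no defect.
For even \<open>a\<close> the degrees on each side sum to at least \<open>3a\<^sup>2/2 - 1\<close>; so, missing arcs and gaps of
both parts taken together, there is at most one defect, and one of the parts is complete.\<close>

lemma two_cycle_exists:
  assumes f: "optimal f" and nh: "\<And>xs. \<not> ham_list xs"
  shows "\<exists>v\<in>V. f (f v) = v"
proof (rule ccontr)
  assume "\<not> ?thesis"
  then have no2: "f (f v) \<noteq> v" if "v \<in> V" for v using that by blast
  note fac = optimal_factor[OF f]
  obtain K where K: "invariant f K" "K \<noteq> {}" "K \<noteq> V" using ham_or_proper_invariant[OF fac] nh by blast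
  have KV: "K \<subseteq> V" using K by (simp add: invariant_def)
  have K': "invariant f (V - K)" by (rule invariant_compl[OF fac K(1)])
  have K'ne: "V - K \<noteq> {}" "V - K \<noteq> V" using K KV by blast+
  have half: "card ((V - K) \<inter> V1) = a - card (K \<inter> V1)" by (rule invariant_card_compl[OF KV])
  have Ka: "card (K \<inter> V1) \<le> a" using card_mono[OF fin1, of "K \<inter> V1"] card1 by simp
  note big = invariant_large[OF f no2 K(1,2)] invariant_large[OF f no2 K' K'ne(1)]
  note two = invariant_at_least_two[OF fac no2 K(1,2)] invariant_at_least_two[OF fac no2 K' K'ne(1)]
  have contra: False if C: "invariant f C" "C \<noteq> {}" "C \<noteq> V"
    and "missing C = {}" "card (gaps f C) < card (C \<inter> V1)" for C
    by (rule complete_part_contradiction[OF f C(1,3) that(4) refl invariant_at_least_two[OF fac no2 C(1,2)] that(5)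
          two_parts_only[OF f no2 C(1,2)]])
  have finm: "finite (missing C)" for C
    unfolding missing_def using fin1 fin2 by auto
  show False
  proof (cases "even a")
    case False
    then obtain b where b: "a = 2 * b + 1" by (metis oddE)
    have tight: False if C: "invariant f C" "C \<noteq> {}" "C \<noteq> V" "card (C \<inter> V1) = b" for C
    proof -
      have b2: "2 \<le> b" using invariant_at_least_two[OF fac no2 C(1,2)] C(4) by simp
      have "2 * (b * (3 * b + 1)) + 2 * card (missing C) + card (gaps f C) \<le> 2 * b * (a + b)"
        by (rule invariant_sum_odd[OF f C(1,4) b2]) (simp add: b)
      then have "card (missing C) = 0" "card (gaps f C) = 0" unfolding b by (simp_all add: algebra_simps)
      then show False using contra[OF C(1-3)] finm[of C] C(4) b2 by simp
    qed
    have "card (K \<inter> V1) = b \<or> card ((V - K) \<inter> V1) = b" using big half b Ka by presburger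
    then show False using tight K K' K'ne by blast
  next
    case True
    then obtain b where b: "a = 2 * b" by blast
    have Kb: "card (K \<inter> V1) = b" "card ((V - K) \<inter> V1) = b" using big half b Ka by presburger+
    have b2: "2 \<le> b" using two Kb by simp
    \<comment> \<open>The gaps of \<open>K\<close> and of its complement correspond, so each of them is counted twice, like a missing arc.\<close>
    have e1: "(\<Sum>v\<in>K. deg A v) + 2 * card (missing K) + card (gaps f K) = 2 * b * (a + b)"
      by (rule degree_count[OF f K(1) Kb(1)])
    have e2: "(\<Sum>v\<in>V - K. deg A v) + 2 * card (missing (V - K)) + card (gaps f (V - K)) = 2 * b * (a + b)"
      by (rule degree_count[OF f K' Kb(2)])
    have e3: "(\<Sum>v\<in>V. deg A v) = (\<Sum>v\<in>K. deg A v) + (\<Sum>v\<in>V - K. deg A v)"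
      using sum.subset_diff[OF KV finV, of "deg A"] by simp
    have s1: "a * (3 * b) \<le> (\<Sum>v\<in>V1. deg A v) + 1" using side_sum_even[of V1 "3 * b"] card1 a3 b by simp
    have s2: "a * (3 * b) \<le> (\<Sum>v\<in>V2. deg A v) + 1" using side_sum_even[of V2 "3 * b"] card2 a3 b by simp
    have e4: "(\<Sum>v\<in>V. deg A v) = (\<Sum>v\<in>V1. deg A v) + (\<Sum>v\<in>V2. deg A v)"
      using fin1 fin2 disj by (rule sum.union_disjoint)
    have g: "card (gaps f (V - K)) = card (gaps f K)" unfolding gaps_compl[OF KV] by simp
    have "a * (3 * b) = 2 * b * (a + b)" unfolding b by (simp add: algebra_simps)
    then have "card (missing K) + card (missing (V - K)) + card (gaps f K) \<le> 1"
      using e1 e2 e3 e4 s1 s2 g by linarith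
    then have "card (missing K) = 0 \<and> card (gaps f K) < b \<or> card (missing (V - K)) = 0 \<and> card (gaps f (V - K)) < b"
      using b2 g by linarith
    then show False using contra[OF K] contra[OF K' K'ne] Kb finm by auto
  qed
qed

section \<open>The second exceptional digraph\<close>

text \<open>The notions that depend on the factor do not depend on the order of the two sides. This allows the sides to be
exchanged when the vertex isolated from a 2-cycle lies in \<open>V2\<close>.\<close>

lemma factor_swap: "meyniel_bipartite.factor V2 V1 A f \<longleftrightarrow> factor f"
proof -
  interpret sw: meyniel_bipartite V2 V1 A a by (rule swap)
  show ?thesis unfolding sw.factor_def factor_def by (simp only: Un_commute)
qed

lemma optimal_swap: "meyniel_bipartite.optimal V2 V1 A f \<longleftrightarrow> optimal f"
proof -
  interpret sw: meyniel_bipartite V2 V1 A a by (rule swap)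
  have "sw.reach g = reach g" for g unfolding sw.reach_def reach_def by (simp only: Un_commute)
  then show ?thesis unfolding sw.optimal_def optimal_def factor_swap by simp
qed

lemma ham_list_swap: "meyniel_bipartite.ham_list V2 V1 A xs \<longleftrightarrow> ham_list xs"
proof -
  interpret sw: meyniel_bipartite V2 V1 A a by (rule swap)
  show ?thesis unfolding sw.ham_list_def ham_list_def by (simp only: Un_commute)
qed

text \<open>As \<open>{x, f x}\<close> has no gaps and no exchange is possible, exactly one of the two arcs is present.\<close>

lemma two_cycle_alt1:
  assumes f: "optimal f" and x: "x \<in> V1" and ff: "f (f x) = x" and z: "z \<in> V1" "z \<noteq> x"
  shows "(z, f x) \<in> A \<longleftrightarrow> (x, f z) \<notin> A"
proof -
  note d = two_cycle[OF f x ff]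
  have nz: "z \<noteq> f x" using z(1) factor_sides(1)[OF optimal_factor[OF f] x] disj by (metis disjoint_iff)
  have "(x, z) \<notin> gaps f {x, f x}" using d(4) by simp
  then have "(x, f z) \<in> A \<or> (z, f x) \<in> A" using x z nz unfolding gaps_def by auto
  moreover have "(z, f x) \<notin> A" if "(x, f z) \<in> A"
    by (rule optimal_no_exchange[OF f d(1) _ _ _ that]) (use z nz in auto)
  ultimately show ?thesis by blast
qed

lemma two_cycle_alt2:
  assumes f: "optimal f" and x: "x \<in> V1" and ff: "f (f x) = x" and z: "z \<in> V2" "z \<noteq> f x"
  shows "(z, x) \<in> A \<longleftrightarrow> (f x, f z) \<notin> A"
proof -
  note d = two_cycle[OF f x ff]
  have y: "f x \<in> V2" by (rule factor_sides(1)[OF optimal_factor[OF f] x])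
  have nz: "z \<noteq> x" using z(1) x disj by (metis disjoint_iff)
  have "(f x, z) \<notin> gaps f {x, f x}" using d(4) by simp
  then have "(f x, f z) \<in> A \<or> (z, x) \<in> A" using y z nz ff unfolding gaps_def by auto
  moreover have "(z, f (f x)) \<notin> A" if "(f x, f z) \<in> A"
    by (rule optimal_no_exchange[OF f d(1) _ _ _ that]) (use z nz in auto)
  ultimately show ?thesis using ff by auto
qed

lemma isolated_from_two_cycle:
  assumes f: "optimal f" and nh: "\<And>xs. \<not> ham_list xs" and x: "x \<in> V1" and ff: "f (f x) = x"
  shows "\<exists>w\<in>V - {x, f x}. (w, x) \<notin> A \<and> (x, w) \<notin> A \<and> (w, f x) \<notin> A \<and> (f x, w) \<notin> A"
proof -
  note fac = optimal_factor[OF f]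
  note cl = two_cycle(1)[OF f x ff]
  have y: "f x \<in> V2" by (rule factor_sides(1)[OF fac x])
  have ne: "{x, f x} \<noteq> V"
  proof
    assume "{x, f x} = V"
    then have "V1 \<subseteq> {x}" using y disj by auto
    then have "card V1 \<le> card {x}" by (intro card_mono) auto
    then show False using card1 a3 by simp
  qed
  have "(\<exists>c\<in>{x, f x}. (z, c) \<in> A) \<noteq> (\<exists>c\<in>{x, f x}. (c, f z) \<in> A)" if z: "z \<in> V - {x, f x}" for z
  proof (cases "z \<in> V1")
    case True
    have "(z, x) \<notin> A" "(f x, f z) \<notin> A" using same_side True x y factor_sides(1)[OF fac True] by blast+
    then show ?thesis using two_cycle_alt1[OF f x ff True] z by simp
  next
    case False
    then have z2: "z \<in> V2" using z by blast
    have "(z, f x) \<notin> A" "(x, f z) \<notin> A" using same_side z2 x y factor_sides(2)[OF fac z2] by blast+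
    then show ?thesis using two_cycle_alt2[OF f x ff z2] z by simp
  qed
  then have "\<exists>w\<in>V - {x, f x}. \<forall>c\<in>{x, f x}. (w, c) \<notin> A \<and> (c, w) \<notin> A"
    using isolated_from_invariant[OF fac cl _ ne two_cycle_rest[OF f nh x ff]] by blast
  then show ?thesis by blast
qed

text \<open>Let \<open>y = f x\<close>. The rest of the digraph is a single cycle \<open>w L g R\<close>, where \<open>g\<close> is joined to \<open>y\<close> in both
directions. As \<open>w\<close> misses both arcs with \<open>y\<close> and has degree at least \<open>2a - 2\<close>, it has all other arcs and
can be inserted after and before any vertex of \<open>V2\<close> other than \<open>y\<close>. For every \<open>v\<close> of \<open>V1\<close> inside
\<open>L\<close> or \<open>R\<close> two hamiltonian cycles that would result from single additional arcs at \<open>v\<close> show that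
these two arcs are missing, so \<open>v\<close> has all remaining arcs, in particular both arcs with \<open>y\<close>. The degree
\<open>a + 1\<close> of \<open>y\<close> then gives \<open>a = 3\<close>.\<close>

lemma two_cycle_H2:
  assumes f: "optimal f" and nh: "\<And>xs. \<not> ham_list xs" and x: "x \<in> V1" and ff: "f (f x) = x"
    and w: "w \<in> V1" "w \<noteq> x" and wy: "(w, f x) \<notin> A" "(f x, w) \<notin> A"
  shows "H2_shape V A"
proof -
  interpret sw: meyniel_bipartite V2 V1 A a by (rule swap)
  note fac = optimal_factor[OF f]
  note cl = two_cycle(1)[OF f x ff]
  define y where "y = f x"
  have fy: "f y = x" using ff by (simp add: y_def)
  have y: "y \<in> V2" unfolding y_def by (rule factor_sides(1)[OF fac x])
  have wy: "(w, y) \<notin> A" "(y, w) \<notin> A" using wy by (simp_all add: y_def)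
  have dy: "deg A y = a + 1" using two_cycle(3)[OF f x ff] by (simp add: y_def)
  have others: "2 * a - 2 \<le> deg A v" if "v \<in> V1" "v \<noteq> x" for v
    using two_cycle_others[OF f x ff, of v] that y disj unfolding y_def by (metis DiffI UnI1 disjoint_iff insertE singletonD)
  have alt1: "(z, y) \<in> A \<longleftrightarrow> (x, f z) \<notin> A" if "z \<in> V1" "z \<noteq> x" for z
    using two_cycle_alt1[OF f x ff that] by (simp add: y_def)
  have alt2: "(z, x) \<in> A \<longleftrightarrow> (y, f z) \<notin> A" if "z \<in> V2" "z \<noteq> y" for z
    using two_cycle_alt2[OF f x ff that(1)] that(2) by (simp add: y_def)
  have ne12: "u \<noteq> v" if "u \<in> V1" "v \<in> V2" for u v using that disj by (metis disjoint_iff)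
  have xy: "(x, y) \<in> A" "(y, x) \<in> A"
    using factor_arc[OF fac, of x] factor_arc[OF fac, of y] x y fy by (auto simp: y_def)
  \<comment> \<open>The orbit of \<open>w\<close> consists of all vertices outside the 2-cycle.\<close>
  have wV: "w \<in> V" using w by blast
  obtain xs where xs: "distinct xs" "xs \<noteq> []" "hd xs = w" "successively (\<lambda>p q. q = f p) xs"
    "f (last xs) = w" "invariant f (set xs)" using orbit_list[OF fac wV] by blast
  have cl': "invariant f (V - {x, y})" unfolding y_def by (rule invariant_compl[OF fac cl])
  have wZ: "w \<in> V - {x, y}" using w y ne12 by auto
  have sub: "set xs \<subseteq> V - {x, y}"
    using iterates_in_invariant[OF xs(4,2), of "V - {x, y}"] xs(3) wZ cl' unfolding invariant_def by blast
  have "set xs \<noteq> {}" using xs(2) by simp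
  then have setxs: "set xs = V - {x, y}"
    using two_cycle_rest[OF f nh x ff xs(6)] sub unfolding y_def by blast
  \<comment> \<open>The vertex \<open>y\<close> has \<open>a - 1\<close> arcs with the \<open>a - 1\<close> vertices of \<open>V1\<close> other than \<open>x\<close>, but none with \<open>w\<close>,
    so it has two with some vertex.\<close>
  have oy: "A `` {y} \<subseteq> V1 - {w}" "A\<inverse> `` {y} \<subseteq> V1 - {w}"
    using sw.out_sub[OF y] sw.in_sub[OF y] wy by blast+
  have fo: "finite (A `` {y})" "finite (A\<inverse> `` {y})" using oy fin1 finite_subset by (metis finite_Diff)+
  have "\<exists>g\<in>V1. g \<noteq> x \<and> (y, g) \<in> A \<and> (g, y) \<in> A"
  proof (rule ccontr)
    assume "\<not> ?thesis"
    then have "A `` {y} \<inter> A\<inverse> `` {y} \<subseteq> {x}" using oy by blast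
    then have "card (A `` {y} \<inter> A\<inverse> `` {y}) \<le> card {x}" by (intro card_mono) auto
    moreover have "card (A `` {y} \<union> A\<inverse> `` {y}) \<le> a - 1"
      by (rule card_le_if_sub_diff[OF fin1 card1 w(1)]) (use oy in blast)
    ultimately show False using card_Un_Int[OF fo] dy a3 unfolding deg_def by simp
  qed
  then obtain g where g: "g \<in> V1" "g \<noteq> x" and yg: "(y, g) \<in> A" "(g, y) \<in> A" by blast
  have gw: "g \<noteq> w" using yg wy by blast
  obtain cs where cs: "xs = w # cs" using xs(2,3) by (cases xs) auto
  have "g \<in> set cs" using setxs g gw ne12[OF g(1) y] unfolding cs by auto
  then obtain L R where LR: "cs = L @ g # R" by (meson split_list)
  have succ: "successively (\<lambda>p q. q = f p) (w # L @ g # R)" using xs(4) unfolding cs LR .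
  have fin: "f (last (g # R)) = w" using xs(5) unfolding cs LR by simp
  have L0: "L \<noteq> []"
  proof
    assume "L = []"
    then have "g = f w" using succ by simp
    then show False using ne12[OF g(1) factor_sides(1)[OF fac w(1)]] by simp
  qed
  have R0: "R \<noteq> []"
  proof
    assume "R = []"
    then have "f g = w" using fin by simp
    then show False using ne12[OF w(1) factor_sides(1)[OF fac g(1)]] by simp
  qed
  have dist: "distinct (w # L @ g # R)" using xs(1) unfolding cs LR .
  have setLR: "insert w (insert g (set L \<union> set R)) = V - {x, y}" using setxs unfolding cs LR by auto
  \<comment> \<open>The cycle reads \<open>w, p, \<dots>, h, g, q, \<dots>, u\<close> with \<open>L\<close> from \<open>p\<close> to \<open>h\<close> and \<open>R\<close> from \<open>q\<close> to \<open>u\<close>.\<close>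
  define p h q u where "p = hd L" and "h = last L" and "q = hd R" and "u = last R"
  have fw: "f w = p" and fh: "f h = g" and fg: "f g = q" and fu: "f u = w"
    using succ fin L0 R0 by (auto simp: successively_append_iff successively_Cons p_def h_def q_def u_def)
  have mem: "p \<in> set L" "h \<in> set L" "q \<in> set R" "u \<in> set R" using L0 R0 by (simp_all add: p_def h_def q_def u_def)
  have LRV: "set L \<subseteq> V - {x, y}" "set R \<subseteq> V - {x, y}" using setLR by blast+
  have p2: "p \<in> V2" "p \<noteq> y" and q2: "q \<in> V2" "q \<noteq> y"
    using factor_sides(1)[OF fac w(1)] factor_sides(1)[OF fac g(1)] fw fg mem LRV by auto
  have side2: "v \<in> V2" if "v \<in> V" "f v \<in> V1" for v using that factor_sides[OF fac, of v] ne12 by blast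
  have h2: "h \<in> V2" "h \<noteq> y" using side2[of h] fh g(1) mem LRV by auto
  have u2: "u \<in> V2" "u \<noteq> y" using side2[of u] fu w(1) mem LRV by auto
  have SL: "successively (\<lambda>p q. (p, q) \<in> A) L" and SR: "successively (\<lambda>p q. (p, q) \<in> A) R"
  proof -
    have s: "successively (\<lambda>p q. q = f p) L" "successively (\<lambda>p q. q = f p) R"
      using succ by (auto simp: successively_append_iff successively_Cons)
    show "successively (\<lambda>p q. (p, q) \<in> A) L"
      by (rule successively_mono[OF s(1)]) (use factor_arc[OF fac] LRV in blast)
    show "successively (\<lambda>p q. (p, q) \<in> A) R"
      by (rule successively_mono[OF s(2)]) (use factor_arc[OF fac] LRV in blast)
  qed
  have hg: "(h, g) \<in> A" using factor_arc[OF fac, of h] h2 fh by auto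
  have gq: "(g, q) \<in> A" using factor_arc[OF fac, of g] g fg by auto
  have ux: "(u, x) \<in> A" using alt2[OF u2] fu wy by simp
  have xp: "(x, p) \<in> A" using alt1[OF w] fw wy by simp
  have xq: "(x, q) \<notin> A" using alt1[OF g] fg yg by simp
  have hx: "(h, x) \<notin> A" using alt2[OF h2] fh yg by simp
  have "A `` {w} = V2 - {y} \<and> A\<inverse> `` {w} = V2 - {y}"
    by (rule two_missing(2)[OF w(1) y wy(1) y wy(2) others[OF w]])
  then have wful: "(w, v) \<in> A" "(v, w) \<in> A" if "v \<in> V2" "v \<noteq> y" for v using that by blast+
  have noham: "(last zs, hd zs) \<notin> A"
    if "distinct zs" "set zs = insert x (insert y (insert w (insert g (set L \<union> set R))))"
      "successively (\<lambda>p q. (p, q) \<in> A) zs" for zs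
  proof -
    have "set zs = insert x (insert y (V - {x, y}))" using that(2) by (simp only: setLR)
    also have "\<dots> = V" using x y by blast
    finally show ?thesis using nh[of zs] that(1,3) unfolding ham_list_def by blast
  qed
  have dist': "distinct L" "distinct R" "set L \<inter> set R = {}" "g \<notin> set L" "g \<notin> set R" "w \<notin> set L" "w \<notin> set R"
    using dist by auto
  have xyLR: "x \<notin> set L" "x \<notin> set R" "y \<notin> set L" "y \<notin> set R" using LRV by blast+
  have nexy: "x \<noteq> y" "w \<noteq> y" "g \<noteq> y" using ne12 x w g y by blast+
  note D = dist' xyLR nexy g(2) w(2) gw
  note S = successively_append_iff successively_Cons
  have double: "(y, v) \<in> A \<and> (v, y) \<in> A" if v: "v \<in> V1" "v \<noteq> w" for v
  proof -
    consider "v = x" | "v = g" | "v \<in> set L" | "v \<in> set R"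
      using setLR v ne12[OF v(1) y] by blast
    then show ?thesis
    proof cases
      case 1 then show ?thesis using xy by simp
    next
      case 2 then show ?thesis using yg by simp
    next
      case 3
      then obtain L1 L2 where L: "L = L1 @ v # L2" by (meson split_list)
      have vp: "v \<noteq> p" and vh: "v \<noteq> h" using ne12[OF v(1)] p2 h2 by blast+
      have L1: "L1 \<noteq> []" using vp L by (auto simp: p_def)
      have L2: "L2 \<noteq> []" using vh L by (auto simp: h_def)
      have hp: "hd L1 = p" "last L2 = h" using L L1 L2 by (simp_all add: p_def h_def)
      have chain: "successively (\<lambda>p q. (p, q) \<in> A) L1" "successively (\<lambda>p q. (p, q) \<in> A) L2"
        "(last L1, v) \<in> A" "(v, hd L2) \<in> A" using SL L1 L2 unfolding L by (auto simp: S)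
      have l1: "last L1 \<in> V2" "last L1 \<noteq> y" and l2: "hd L2 \<in> V2" "hd L2 \<noteq> y"
        using arc_sides[OF chain(3)] arc_sides[OF chain(4)] v(1) ne12 xyLR L L1 L2 by auto
      have "(v, q) \<notin> A"
      proof
        assume vq: "(v, q) \<in> A"
        have "(last (x # L1 @ v # R @ w # L2 @ [g, y]), hd (x # L1 @ v # R @ w # L2 @ [g, y])) \<notin> A"
          by (rule noham) (use D SR chain L1 L2 R0 hp xp vq wful(1)[OF l2] wful(2)[OF u2] hg yg in
              \<open>auto simp: L S q_def u_def\<close>)
        then show False using xy by simp
      qed
      moreover have "(u, v) \<notin> A"
      proof
        assume uv: "(u, v) \<in> A"
        have "(last (x # L1 @ w # R @ v # L2 @ [g, y]), hd (x # L1 @ w # R @ v # L2 @ [g, y])) \<notin> A"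
          by (rule noham) (use D SR chain L1 L2 R0 hp xp uv wful(2)[OF l1] wful(1)[OF q2] hg yg in
              \<open>auto simp: L S q_def u_def\<close>)
        then show False using xy by simp
      qed
      moreover have "v \<noteq> x" using 3 xyLR by blast
      ultimately have "A `` {v} = V2 - {q} \<and> A\<inverse> `` {v} = V2 - {u}"
        by (intro two_missing(2)[OF v(1) q2(1) _ u2(1)] others v(1))
      then show ?thesis using y q2 u2 by blast
    next
      case 4
      then obtain R1 R2 where R: "R = R1 @ v # R2" by (meson split_list)
      have vq: "v \<noteq> q" and vu: "v \<noteq> u" using ne12[OF v(1)] q2 u2 by blast+
      have R1: "R1 \<noteq> []" using vq R by (auto simp: q_def)
      have R2: "R2 \<noteq> []" using vu R by (auto simp: u_def)
      have hp: "hd R1 = q" "last R2 = u" using R R1 R2 by (simp_all add: q_def u_def)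
      have chain: "successively (\<lambda>p q. (p, q) \<in> A) R1" "successively (\<lambda>p q. (p, q) \<in> A) R2"
        "(last R1, v) \<in> A" "(v, hd R2) \<in> A" using SR R1 R2 unfolding R by (auto simp: S)
      have l1: "last R1 \<in> V2" "last R1 \<noteq> y" and l2: "hd R2 \<in> V2" "hd R2 \<noteq> y"
        using arc_sides[OF chain(3)] arc_sides[OF chain(4)] v(1) ne12 xyLR R R1 R2 by auto
      have "(v, p) \<notin> A"
      proof
        assume vp: "(v, p) \<in> A"
        have "(last (y # g # R1 @ v # L @ w # R2 @ [x]), hd (y # g # R1 @ v # L @ w # R2 @ [x])) \<notin> A"
          by (rule noham) (use D SL chain R1 R2 L0 hp gq ux vp wful(1)[OF l2] wful(2)[OF h2] yg in
              \<open>auto simp: R S p_def h_def\<close>)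
        then show False using xy by simp
      qed
      moreover have "(h, v) \<notin> A"
      proof
        assume hv: "(h, v) \<in> A"
        have "(last (y # g # R1 @ w # L @ v # R2 @ [x]), hd (y # g # R1 @ w # L @ v # R2 @ [x])) \<notin> A"
          by (rule noham) (use D SL chain R1 R2 L0 hp gq ux hv wful(2)[OF l1] wful(1)[OF p2] yg in
              \<open>auto simp: R S p_def h_def\<close>)
        then show False using xy by simp
      qed
      moreover have "v \<noteq> x" using 4 xyLR by blast
      ultimately have "A `` {v} = V2 - {p} \<and> A\<inverse> `` {v} = V2 - {h}"
        by (intro two_missing(2)[OF v(1) p2(1) _ h2(1)] others v(1))
      then show ?thesis using y p2 h2 by blast
    qed
  qed
  have a: "a = 3"
  proof -
    have "V1 - {w} \<subseteq> A `` {y}" "V1 - {w} \<subseteq> A\<inverse> `` {y}" using double by blast+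
    then have "card (V1 - {w}) \<le> card (A `` {y})" "card (V1 - {w}) \<le> card (A\<inverse> `` {y})"
      using card_mono fo by blast+
    moreover have "card (V1 - {w}) = a - 1" using w card1 fin1 by simp
    ultimately show ?thesis using dy a3 unfolding deg_def by linarith
  qed
  have pq: "p \<noteq> q" using mem dist' by blast
  have "card {x, w, g} = 3" using D by simp
  then have V1: "V1 = {x, w, g}" using x w g card1 a fin1 card_subset_eq[of V1 "{x, w, g}"] by simp
  have "card {y, p, q} = 3" using pq p2 q2 by simp
  then have V2: "V2 = {y, p, q}" using y p2 q2 card2 a fin2 card_subset_eq[of V2 "{y, p, q}"] by simp
  \<comment> \<open>For \<open>a = 3\<close> both \<open>L\<close> and \<open>R\<close> consist of a single vertex, and it remains to find the absent arcs at \<open>g\<close>.\<close>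
  have hp: "h = p" using h2 V2 mem dist' by blast
  have uq: "u = q" using u2 V2 mem dist' by blast
  have ug: "(u, g) \<notin> A"
  proof
    assume ug: "(u, g) \<in> A"
    have "(last (x # L @ w # R @ [g, y]), hd (x # L @ w # R @ [g, y])) \<notin> A"
      by (rule noham) (use D SL SR L0 R0 xp ug wful(2)[OF h2] wful(1)[OF q2] yg in
          \<open>auto simp: S p_def h_def q_def u_def\<close>)
    then show False using xy by simp
  qed
  have gp: "(g, p) \<notin> A"
  proof
    assume gp: "(g, p) \<in> A"
    have "(last (y # g # L @ w # R @ [x]), hd (y # g # L @ w # R @ [x])) \<notin> A"
      by (rule noham) (use D SL SR L0 R0 ux gp wful(2)[OF h2] wful(1)[OF q2] yg in
          \<open>auto simp: S p_def h_def q_def u_def\<close>)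
    then show False using xy by simp
  qed
  let ?H = "{(x, p), (p, g), (g, q), (q, x), (w, p), (p, w), (w, q), (q, w), (y, x), (x, y), (y, g), (g, y)}"
  have in_A: "?H \<subseteq> A"
    using xp hg hp gq ux uq wful(1)[OF p2] wful(2)[OF p2] wful(1)[OF q2] wful(2)[OF q2] xy yg by simp
  have "{x, w, g} \<times> {y, p, q} \<union> {y, p, q} \<times> {x, w, g} \<subseteq> ?H \<union> {(x, q), (p, x), (w, y), (y, w), (g, p), (q, g)}"
    by simp
  then have "A \<subseteq> ?H \<union> {(x, q), (p, x), (w, y), (y, w), (g, p), (q, g)}"
    using bip unfolding V1 V2 by (rule order_trans[rotated])
  moreover have "A \<inter> {(x, q), (p, x), (w, y), (y, w), (g, p), (q, g)} = {}"
    using xq hx hp wy gp ug uq by simp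
  ultimately have "A \<subseteq> ?H" by (rule subset_of_Un_disjoint)
  then have eqA: "A = ?H" using in_A by (rule subset_antisym)
  have "distinct [x, w, g, y, p, q]"
    using D pq p2 q2 ne12[OF x] ne12[OF w(1)] ne12[OF g(1)] by auto
  moreover have "V = {x, w, g, y, p, q}" unfolding V1 V2 by auto
  ultimately show ?thesis unfolding H2_shape_def using eqA by blast
qed

lemma ham_or_exceptional:
  "(\<exists>xs. ham_list xs) \<or> H1_shape V1 V2 A a \<or> H1_shape V2 V1 A a \<or> H2_shape V A"
proof (rule ccontr)
  assume n: "\<not> ?thesis"
  then have nh: "\<not> ham_list xs" for xs by blast
  obtain f0 where "factor f0" using n factor_or_H1_shape by blast
  then obtain f where f: "optimal f" using optimal_exists by blast
  note fac = optimal_factor[OF f]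
  interpret sw: meyniel_bipartite V2 V1 A a by (rule swap)
  have f': "sw.optimal f" using f by (simp only: optimal_swap)
  have nh': "\<not> sw.ham_list xs" for xs unfolding ham_list_swap by (rule nh)
  obtain v where v: "v \<in> V" "f (f v) = v" using two_cycle_exists[OF f nh] by blast
  obtain x where x: "x \<in> V1" "f (f x) = x"
    using v factor_sides[OF fac, of v] by (metis UnE)
  have y: "f x \<in> V2" "f (f (f x)) = f x" using x factor_sides(1)[OF fac x(1)] by simp_all
  obtain w where w: "w \<in> V - {x, f x}" "(w, x) \<notin> A" "(x, w) \<notin> A" "(w, f x) \<notin> A" "(f x, w) \<notin> A"
    using isolated_from_two_cycle[OF f nh x] by blast
  have "H2_shape V A"
  proof (cases "w \<in> V1")
    case True
    then show ?thesis using two_cycle_H2[OF f nh x True _ w(4,5)] w(1) by blast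
  next
    case False
    then have w2: "w \<in> V2" "w \<noteq> f x" using w(1) by blast+
    have "H2_shape (V2 \<union> V1) A"
      by (rule sw.two_cycle_H2[OF f' nh' y w2]) (use w x in simp_all)
    then show ?thesis by (simp only: Un_commute)
  qed
  then show False using n by blast
qed

end

section \<open>From relations back to digraphs\<close>

context digraph
begin

lemma degree_eq_deg: "degree G v = deg (arcs_ends G) v"
proof -
  have "inj_on (head G) (out_arcs G v)"
    by (rule inj_onI, rule no_multi_arcs) (auto simp: out_arcs_def arc_to_ends_def)
  moreover have "head G ` out_arcs G v = arcs_ends G `` {v}"
    by (auto simp: out_arcs_def arcs_ends_conv image_iff)
  ultimately have o: "out_degree G v = card (arcs_ends G `` {v})"
    unfolding out_degree_def using card_image by fastforce
  have "inj_on (tail G) (in_arcs G v)"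
    by (rule inj_onI, rule no_multi_arcs) (auto simp: in_arcs_def arc_to_ends_def)
  moreover have "tail G ` in_arcs G v = (arcs_ends G)\<inverse> `` {v}"
    by (auto simp: in_arcs_def arcs_ends_conv image_iff)
  ultimately have "in_degree G v = card ((arcs_ends G)\<inverse> `` {v})"
    unfolding in_degree_def using card_image by fastforce
  then show ?thesis using o by (simp add: degree_def deg_def)
qed

lemma strongly_connected_cut:
  assumes sc: "strongly_connected G" and X: "X \<subseteq> verts G" "X \<noteq> {}" "X \<noteq> verts G"
  shows "\<exists>u\<in>X. \<exists>v\<in>verts G - X. (u, v) \<in> arcs_ends G"
proof (rule ccontr)
  assume n: "\<not> ?thesis"
  obtain u v where uv: "u \<in> X" "v \<in> verts G" "v \<notin> X" using X by blast
  have "(u, v) \<in> rtrancl_on (verts G) (arcs_ends G)"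
    using sc uv X(1) unfolding strongly_connected_def reachable_def by blast
  then have "v \<in> X" by (induction rule: rtrancl_on_induct) (use n uv in blast)+
  then show False using uv by blast
qed

text \<open>The tails of the arcs are listed as well, because \<open>hamiltonian\<close> speaks about the tails of the arcs
of a cycle.\<close>

lemma walk_of_vertex_list:
  "xs \<noteq> [] \<Longrightarrow> set xs \<subseteq> verts G \<Longrightarrow> successively (\<lambda>u v. (u, v) \<in> arcs_ends G) xs \<Longrightarrow>
    \<exists>p. awalk (hd xs) p (last xs) \<and> awalk_verts (hd xs) p = xs \<and> map (tail G) p = butlast xs"
proof (induction xs rule: induct_list012)
  case (2 x)
  then show ?case by (intro exI[of _ "[]"]) (simp add: awalk_Nil_iff)
next
  case (3 x y zs)
  then obtain p where p: "awalk y p (last (y # zs))" "awalk_verts y p = y # zs" "map (tail G) p = butlast (y # zs)"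
    by auto
  obtain e where e: "e \<in> arcs G" "tail G e = x" "head G e = y" using 3(5) by (auto simp: arcs_ends_conv)
  show ?case by (rule exI[of _ "e # p"]) (use p e in \<open>simp add: awalk_Cons_iff\<close>)
qed simp

lemma hamiltonian_of_vertex_list:
  assumes xs: "distinct xs" "xs \<noteq> []" "set xs = verts G" "successively (\<lambda>u v. (u, v) \<in> arcs_ends G) xs"
    "(last xs, hd xs) \<in> arcs_ends G"
  shows "hamiltonian G"
proof -
  have ne: "xs @ [hd xs] \<noteq> []" "set (xs @ [hd xs]) \<subseteq> verts G"
    using xs(2,3) hd_in_set by auto
  have "successively (\<lambda>u v. (u, v) \<in> arcs_ends G) (xs @ [hd xs])"
    using xs by (simp add: successively_append_iff)
  from walk_of_vertex_list[OF ne this] obtain p where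
    p: "awalk (hd xs) p (hd xs)" "awalk_verts (hd xs) p = xs @ [hd xs]" "map (tail G) p = xs"
    using xs(2) by (auto simp: butlast_append)
  have "tl (xs @ [hd xs]) = tl xs @ [hd xs]" using xs(2) by simp
  moreover have "distinct (tl xs @ [hd xs])" using xs(1,2) by (cases xs) auto
  moreover have "p \<noteq> []" using p(3) xs(2) by auto
  ultimately have "cycle p" unfolding cycle_def using p by metis
  moreover have "tail G ` set p = verts G" using p(3) xs(3) by (metis list.set_map)
  ultimately show ?thesis unfolding hamiltonian_def by blast
qed

lemma H2_iso_of_shape:
  assumes "H2_shape (verts G) (arcs_ends G)"
  shows "digraph_iso G (with_proj H2)"
proof -
  obtain x1 x2 x3 y1 y2 y3 where d: "distinct [x1, x2, x3, y1, y2, y3]"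
    and V: "verts G = {x1, x2, x3, y1, y2, y3}"
    and A: "arcs_ends G = {(x1, y2), (y2, x3), (x3, y3), (y3, x1), (x2, y2), (y2, x2), (x2, y3), (y3, x2),
          (y1, x1), (x1, y1), (y1, x3), (x3, y1)}"
    using assms unfolding H2_shape_def by blast
  define \<phi> where "\<phi> = (\<lambda>v. if v = x1 then X1 else if v = x2 then X2 else if v = x3 then X3 else
    if v = y1 then Y1 else if v = y2 then Y2 else Y3)"
  have \<phi>: "\<phi> x1 = X1" "\<phi> x2 = X2" "\<phi> x3 = X3" "\<phi> y1 = Y1" "\<phi> y2 = Y2" "\<phi> y3 = Y3"
    using d by (auto simp: \<phi>_def)
  define hom where "hom = \<lparr>iso_verts = \<phi>, iso_arcs = (\<lambda>e. (\<phi> (tail G e), \<phi> (head G e))),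
    iso_head = snd, iso_tail = fst\<rparr>"
  have inj: "inj_on \<phi> (verts G)" unfolding V inj_on_def by (simp add: \<phi>)
  have "inj_on (iso_arcs hom) (arcs G)"
  proof (rule inj_onI, rule no_multi_arcs)
    fix e e' assume e: "e \<in> arcs G" "e' \<in> arcs G" "iso_arcs hom e = iso_arcs hom e'"
    then show "arc_to_ends G e = arc_to_ends G e'"
      using inj_onD[OF inj] by (simp add: hom_def arc_to_ends_def)
  qed
  then have "digraph_isomorphism hom"
    unfolding digraph_isomorphism_def using inj wf_digraph by (simp add: hom_def)
  moreover have "with_proj H2 = app_iso hom G"
  proof -
    have "\<phi> ` verts G = {X1, X2, X3, Y1, Y2, Y3}" unfolding V by (simp add: \<phi>)
    moreover have "(\<lambda>e. (\<phi> (tail G e), \<phi> (head G e))) ` arcs G = (\<lambda>(u, v). (\<phi> u, \<phi> v)) ` arcs_ends G"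
      unfolding arcs_ends_conv image_image by simp
    then have "(\<lambda>e. (\<phi> (tail G e), \<phi> (head G e))) ` arcs G = parcs H2"
      unfolding A by (simp add: \<phi> H2_def)
    ultimately show ?thesis by (simp add: app_iso_def with_proj_def hom_def H2_def)
  qed
  ultimately show ?thesis unfolding digraph_iso_def by blast
qed

lemma iso_refl: "digraph_iso G G"
proof -
  let ?hom = "\<lparr>iso_verts = id, iso_arcs = id, iso_head = head G, iso_tail = tail G\<rparr>"
  have "digraph_isomorphism ?hom" unfolding digraph_isomorphism_def using wf_digraph by simp
  moreover have "G = app_iso ?hom G" by (simp add: app_iso_def)
  ultimately show ?thesis unfolding digraph_iso_def by blast
qed

end

theorem theorem3p1:
  fixes D :: "('a, 'b) pre_digraph" and V1 V2 :: "'a set" and a :: nat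
  assumes "digraph D"
    and "strongly_connected D"
    and "partite_sets D V1 V2"
    and "card V1 = card V2"
    and "card (verts D) = 2 * a"
    and "a \<ge> 3"
    and "condition_M (- 1) a D"
  shows "hamiltonian D
    \<or> (\<exists>H \<in> (H1_family :: ('a, 'b) pre_digraph set). digraph_iso D H)
    \<or> digraph_iso D (with_proj H2)"
proof -
  interpret digraph D by (rule assms(1))
  have V: "verts D = V1 \<union> V2" and disj: "V1 \<inter> V2 = {}"
    and ind: "independent_set D V1" "independent_set D V2"
    using assms(3) by (auto simp: partite_sets_def)
  have fin: "finite V1" "finite V2" using V finite_verts by auto
  have "card V1 + card V2 = 2 * a" using assms(5) card_Un_disjoint[OF fin disj] V by simp
  then have cards: "card V1 = a" "card V2 = a" using assms(4) by simp_all
  interpret meyniel_bipartite V1 V2 "arcs_ends D" a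
  proof (unfold_locales)
    show "arcs_ends D \<subseteq> V1 \<times> V2 \<union> V2 \<times> V1"
    proof (rule subrelI)
      fix u v assume uv: "(u, v) \<in> arcs_ends D"
      then obtain e where "e \<in> arcs D" "tail D e = u" "head D e = v" by (rule reachableE)
      then have "u \<in> verts D" "v \<in> verts D" by auto
      then have "u \<in> V1 \<union> V2" "v \<in> V1 \<union> V2" unfolding V .
      then show "(u, v) \<in> V1 \<times> V2 \<union> V2 \<times> V1" using ind uv unfolding independent_set_def by blast
    qed
    show "\<exists>u\<in>X. \<exists>v\<in>V1 \<union> V2 - X. (u, v) \<in> arcs_ends D"
      if "X \<subseteq> V1 \<union> V2" "X \<noteq> {}" "X \<noteq> V1 \<union> V2" for X
      using strongly_connected_cut[OF assms(2), of X] that V by simp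
    show "3 * a \<le> deg (arcs_ends D) u + deg (arcs_ends D) v + 1"
      if "u \<in> V1 \<union> V2" "v \<in> V1 \<union> V2" "u \<noteq> v" "(u, v) \<notin> arcs_ends D" "(v, u) \<notin> arcs_ends D" for u v
    proof -
      have "nonadjacent D u v" using that V by (simp add: nonadjacent_def)
      then have "int (degree D u) + int (degree D v) \<ge> 3 * int a + - 1"
        using assms(7) unfolding condition_M_def by blast
      then show ?thesis unfolding degree_eq_deg by linarith
    qed
  qed (use fin disj cards assms(6) in auto)
  have H1: "D \<in> H1_family" if h: "H1_shape W1 W2 (arcs_ends D) a" "partite_sets D W1 W2" for W1 W2
  proof -
    obtain S R U W E where s: "odd a"
      "W1 = S \<union> R" "S \<inter> R = {}" "W2 = U \<union> W" "U \<inter> W = {}"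
      "card S = (a + 1) div 2" "card W = (a + 1) div 2" "card U = (a - 1) div 2" "card R = (a - 1) div 2"
      "arcs_ends D = (R \<times> W \<union> W \<times> R) \<union> (U \<times> S \<union> S \<times> U) \<union> W \<times> S \<union> E"
      "E \<subseteq> R \<times> U \<union> U \<times> R" "\<exists>r\<in>R. \<exists>u\<in>U. (u, r) \<in> E"
      "\<forall>r\<in>R. card (E \<inter> ({r} \<times> U \<union> U \<times> {r})) \<ge> (a - 3) div 2"
      "\<forall>u\<in>U. card (E \<inter> ({u} \<times> R \<union> R \<times> {u})) \<ge> (a - 3) div 2"
      using h(1) unfolding H1_shape_def by (elim conjE exE) (rule that)
    show ?thesis
      unfolding H1_family_def
      by (rule CollectI, rule conjI[OF assms(1)], rule exI[of _ a], rule exI[of _ W1], rule exI[of _ W2],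
          rule exI[of _ S], rule exI[of _ R], rule exI[of _ U], rule exI[of _ W], rule exI[of _ E], intro conjI)
        (fact s assms(5,6) h(2))+
  qed
  have "partite_sets D V2 V1" using assms(3) unfolding partite_sets_def by (simp add: Un_commute Int_commute)
  then have "D \<in> H1_family" if "H1_shape V1 V2 (arcs_ends D) a \<or> H1_shape V2 V1 (arcs_ends D) a"
    using H1 assms(3) that by blast
  moreover have "hamiltonian D" if "ham_list xs" for xs
  proof (rule hamiltonian_of_vertex_list[of xs])
    show "xs \<noteq> []" using that nonempty(1) unfolding ham_list_def by auto
  qed (use that in \<open>simp_all add: ham_list_def V\<close>)
  moreover have "digraph_iso D (with_proj H2)" if "H2_shape (V1 \<union> V2) (arcs_ends D)"
    using H2_iso_of_shape that V by simp
  ultimately show ?thesis using ham_or_exceptional iso_refl by blast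
qed

end
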